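(* Let $N\ge0$ be an integer, $\alpha\in(0,1]$, $p\ge0$, and let $h\in\mathcal{H}^N_{\alpha,p}$. Let $X_1,\dots,X_n$ be independent zero-mean real random variables with variances $\sigma_i^2>0$, having finite moments of order $N+\max(\alpha+p,2)$. Let $W=X_1+\cdots+X_n$, $\sigma_W^2=\mathrm{Var}(W)$, $W^{(i)}=W-X_i$, and let $X_i^*$ be a random variable having the zero biased distribution of $X_i$ and independent of $W^{(i)}$. Define $C_0(h)=\Phi_{\sigma_W}(h)$, $e_0(h)=\mathbb{E}[h(W)]-\Phi_{\sigma_W}(h)$ and, recursively for $N\ge1$, $$C_N(h)=C_0(h)+\sum_{i=1}^n\sigma_i^2\sum_{d\ge1}(-1)^{d-1}\sum_{\mathbf{J}\in\mathbb{N}_*^d,\ |\mathbf{J}|\le N} m_{X_i}^{(\mathbf{J}^\circ)}\big(m_{X_i^*}^{(\mathbf{J}^\dagger)}-m_{X_i}^{(\mathbf{J}^\dagger)}\big)\,C_{N-|\mathbf{J}|}\big(f_h^{(|\mathbf{J}|+1)}\big),$$ $$e_N(h)=\sum_{i=1}^n\sigma_i^2\bigg[\sum_{d\ge1}(-1)^{d-1}\sum_{\mathbf{J}\in\mathbb{N}_*^d,\ |\mathbf{J}|\le N} m_{X_i}^{(\mathbf{J}^\circ)}\big(m_{X_i^*}^{(\mathbf{J}^\dagger)}-m_{X_i}^{(\mathbf{J}^\dagger)}\big)\,e_{N-|\mathbf{J}|}\big(f_h^{(|\mathbf{J}|+1)}\big)+\sum_{k=0}^N\varepsilon_{N-k}\big(f_h^{(k+1)},W^{(i)},X_i\big)\,m_{X_i^*}^{(k)}+\delta_N\big(f_h',W^{(i)},X_i^*\big)\bigg].$$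 Then all terms in these formulas are well defined, and $$\mathbb{E}[h(W)]=C_N(h)+e_N(h).$$
   Context: Zero bias: for a mean-zero random variable $X$ with variance $\sigma^2\in(0,\infty)$, $X^*$ has the zero biased distribution of $X$ if $\mathbb{E}[Xf(X)]=\sigma^2\mathbb{E}[f'(X^* )]$ for every differentiable $f$ for which this is well defined. Normal expectation and Stein's equation: $\phi_\sigma$ is the density of $N(0,\sigma^2)$ and $\Phi_\sigma(h)$ the expectation of $h$ under $N(0,\sigma^2)$. Throughout $\sigma=\sigma_W$, and for a function $h$, $$f_h(x)=\frac{1}{\sigma^2\phi_\sigma(x)}\int_x^\infty\big(h(t)-\Phi_\sigma(h)\big)\phi_\sigma(t)\,dt,$$ which solves Stein's equation $xf_h(x)-\sigma^2f_h'(x)=h(x)-\Phi_\sigma(h)$. $f_h^{(l)}$ is the $l$-th derivative of $f_h$. Multi-indices and moments: $\mathbb{N}_*=\{1,2,\dots\}$; $m_Y^{(k)}:=\mathbb{E}[Y^k]/k!$; for $\mathbf{J}=(j_1,\dots,j_d)\in\mathbb{N}_*^d$, $|\mathbf{J}|=j_1+\cdots+j_d$ and $m_Y^{(\mathbf{J})}=m_Y^{(j_1)}\cdots m_Y^{(j_d)}$; $\mathbb{N}_*^0=\{\emptyset\}$, $|\emptyset|=0$, $m_Y^{(\emptyset)}=1$. For $d\ge1$, $\mathbf{J}^\dagger\in\mathbb{N}_*$ is the last coordinate of $\mathbf{J}$, and $\mathbf{J}^\circ\in\mathbb{N}_*^{d-1}$ is $\mathbf{J}$ with the last coordinate omitted.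 Remainders: for independent $X,Y$ and an integer $M\ge0$, $$\delta_M(f,X,Y)=\mathbb{E}[f(X+Y)]-\sum_{k=0}^M m_Y^{(k)}\mathbb{E}[f^{(k)}(X)],$$ $$\varepsilon_M(f,X,Y)=-\sum_{d\ge0}(-1)^d\sum_{\mathbf{J}\in\mathbb{N}_*^d,\ |\mathbf{J}|\le M}m_Y^{(\mathbf{J})}\delta_{M-|\mathbf{J}|}(f^{(|\mathbf{J}|)},X,Y).$$ Function space: a function $g$ on $\mathbb{R}$ locally of finite variation is uniquely $g=g_c+g_d$, with $g_c$ continuous, locally of finite variation, $g_c(0)=0$ (continuous part), and $g_d$ a pure jump function (purely discontinuous part). For $\alpha\in(0,1]$, $p\ge0$, $$\|f\|_{\alpha,p}:=\sup_{x\ne y}\frac{|f(x)-f(y)|}{|x-y|^\alpha(1+|x|^p+|y|^p)}.$$ $\mathcal{H}^N_{\alpha,p}$ is the vector space of Borel functions $h$ on $\mathbb{R}$ such that (a) $h$ has an $N$-th order derivative $h^{(N)}$ which is locally of finite variation and has finitely many jumps, and (b) the continuous part of $h^{(N)}$ satisfies $\|h^{(N)}_c\|_{\alpha,p}<+\infty$. Since $h^{(N)}$ may jump, for $N\ge1$ "$N$-th derivative" means that $h^{(N-1)}$ is a primitive of $h^{(N)}$ (e.g. $(x-k)_+$ has derivative an indicator function and lies in $\mathcal{H}^1_{\alpha,0}$); likewise, derivatives of $f_h$ at jump points are the ones given by Stein's equation and its derivatives. *)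

theory Defs
  imports "HOL-Probability.Probability"
begin

section \<open>Functions with derivatives, and the space of test functions\<close>

text \<open>
  An \<open>N\<close>-th derivative that may jump is determined by the function only up to its values at the
  jumps, and expectations under laws with atoms see these values. A function is therefore
  represented together with a choice of derivatives: \<open>h k\<close> is the \<open>k\<close>-th derivative and \<open>h 0\<close> the
  function itself. Only the entries up to the order in question are relevant.
\<close>

type_synonym jet = "nat \<Rightarrow> real \<Rightarrow> real"

definition jet_deriv :: "nat \<Rightarrow> jet \<Rightarrow> jet" where
  "jet_deriv k f = (\<lambda>l. f (l + k))"

text \<open>
  Derivatives below the top order are classical ones; at the top order, \<open>h (N - 1)\<close> is a primitive
  of \<open>h N\<close>.
\<close>

definition has_derivs :: "nat \<Rightarrow> jet \<Rightarrow> bool" where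
  "has_derivs N h \<longleftrightarrow>
     (\<forall>k x. Suc k < N \<longrightarrow> (h k has_real_derivative h (Suc k) x) (at x)) \<and>
     (0 < N \<longrightarrow> (\<forall>a b. a \<le> b \<longrightarrow>
        set_integrable lborel {a..b} (h N) \<and>
        h (N - 1) b - h (N - 1) a = (LINT t:{a..b}|lborel. h N t)))"

definition locally_bv :: "(real \<Rightarrow> real) \<Rightarrow> bool" where
  "locally_bv g \<longleftrightarrow> (\<forall>a b. bdd_above
     {(\<Sum>i<m. \<bar>g (t (Suc i)) - g (t i)\<bar>) | (m::nat) t.
        a \<le> t 0 \<and> (\<forall>i<m. t i \<le> t (Suc i)) \<and> t m \<le> b})"

text \<open>
  The increment of a pure jump function from \<open>a+\<close> to \<open>b-\<close> is the sum of its jumps in between. The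
  values at the jumps are not constrained.
\<close>

definition pure_jump :: "(real \<Rightarrow> real) \<Rightarrow> bool" where
  "pure_jump g \<longleftrightarrow> locally_bv g \<and>
     (\<forall>a b. a < b \<longrightarrow>
        ((\<lambda>y. Lim (at_right y) g - Lim (at_left y) g)
           has_sum (Lim (at_left b) g - Lim (at_right a) g)) {a<..<b})"

definition is_continuous_part :: "(real \<Rightarrow> real) \<Rightarrow> (real \<Rightarrow> real) \<Rightarrow> bool" where
  "is_continuous_part g gc \<longleftrightarrow>
     continuous_on UNIV gc \<and> locally_bv gc \<and> gc 0 = 0 \<and> pure_jump (\<lambda>x. g x - gc x)"

text \<open>\<open>\<bar>x\<bar>\<^sup>p\<close> for \<open>p \<ge> 0\<close>, with \<open>0\<^sup>0 = 1\<close> (while \<open>0 powr 0 = 0\<close>).\<close>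

definition abs_pow :: "real \<Rightarrow> real \<Rightarrow> real" where
  "abs_pow p x = (if p = 0 then 1 else \<bar>x\<bar> powr p)"

definition hoelder_norm :: "real \<Rightarrow> real \<Rightarrow> (real \<Rightarrow> real) \<Rightarrow> ennreal" where
  "hoelder_norm \<alpha> p f = (SUP (x, y) \<in> {(x, y). x \<noteq> y}.
     ennreal (\<bar>f x - f y\<bar> / (\<bar>x - y\<bar> powr \<alpha> * (1 + abs_pow p x + abs_pow p y))))"

text \<open>
  A function locally of finite variation has one-sided limits everywhere, so its discontinuities
  are its jumps.
\<close>

definition HN :: "nat \<Rightarrow> real \<Rightarrow> real \<Rightarrow> jet set" where
  "HN N \<alpha> p = {h. h 0 \<in> borel_measurable borel \<and>
     has_derivs N h \<and> locally_bv (h N) \<and> finite {x. \<not> isCont (h N) x} \<and>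
     (\<exists>gc. is_continuous_part (h N) gc \<and> hoelder_norm \<alpha> p gc < \<infinity>)}"


section \<open>Stein's equation\<close>

definition Phi :: "real \<Rightarrow> (real \<Rightarrow> real) \<Rightarrow> real" where
  "Phi \<sigma> g = (\<integral>x. g x \<partial>density lborel (normal_density 0 \<sigma>))"

definition Phi_wd :: "real \<Rightarrow> (real \<Rightarrow> real) \<Rightarrow> bool" where
  "Phi_wd \<sigma> g \<longleftrightarrow> integrable (density lborel (normal_density 0 \<sigma>)) g"

text \<open>
  The derivatives of the solution \<open>stein \<sigma> h 0\<close> are the ones given by Stein's equation
  \<open>x f - \<sigma>\<^sup>2 f' = h - \<Phi>(h)\<close> and its derivatives
  \<open>x f\<^sup>(\<^sup>l\<^sup>) + l f\<^sup>(\<^sup>l\<^sup>-\<^sup>1\<^sup>) - \<sigma>\<^sup>2 f\<^sup>(\<^sup>l\<^sup>+\<^sup>1\<^sup>) = h\<^sup>(\<^sup>l\<^sup>)\<close>.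
\<close>

fun stein :: "real \<Rightarrow> jet \<Rightarrow> jet" where
  "stein \<sigma> h 0 x =
     1 / (\<sigma>\<^sup>2 * normal_density 0 \<sigma> x) *
     (LINT t:{x..}|lborel. (h 0 t - Phi \<sigma> (h 0)) * normal_density 0 \<sigma> t)"
| "stein \<sigma> h (Suc 0) x = (x * stein \<sigma> h 0 x - (h 0 x - Phi \<sigma> (h 0))) / \<sigma>\<^sup>2"
| "stein \<sigma> h (Suc (Suc l)) x =
     (x * stein \<sigma> h (Suc l) x + real (Suc l) * stein \<sigma> h l x - h (Suc l) x) / \<sigma>\<^sup>2"

definition stein_wd :: "nat \<Rightarrow> real \<Rightarrow> jet \<Rightarrow> bool" where
  "stein_wd N \<sigma> h \<longleftrightarrow>
     Phi_wd \<sigma> (h 0) \<and>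
     (\<forall>x. set_integrable lborel {x..} (\<lambda>t. (h 0 t - Phi \<sigma> (h 0)) * normal_density 0 \<sigma> t)) \<and>
     has_derivs N (stein \<sigma> h)"


section \<open>Zero bias\<close>

definition Var :: "'a measure \<Rightarrow> ('a \<Rightarrow> real) \<Rightarrow> real" where
  "Var P X = prob_space.variance P X"

text \<open>\<open>Y\<close> has the zero biased distribution of \<open>X\<close>.\<close>

definition zero_biased :: "'a measure \<Rightarrow> ('a \<Rightarrow> real) \<Rightarrow> ('a \<Rightarrow> real) \<Rightarrow> bool" where
  "zero_biased P X Y \<longleftrightarrow> Y \<in> borel_measurable P \<and>
     (\<forall>f f'. (\<forall>x. (f has_real_derivative f' x) (at x)) \<and>
        integrable P (\<lambda>\<omega>. X \<omega> * f (X \<omega>)) \<and> integrable P (\<lambda>\<omega>. f' (Y \<omega>)) \<longrightarrow>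
        (\<integral>\<omega>. X \<omega> * f (X \<omega>) \<partial>P) = Var P X * (\<integral>\<omega>. f' (Y \<omega>) \<partial>P))"


section \<open>Moments, multi-indices and remainders\<close>

definition mom :: "'a measure \<Rightarrow> ('a \<Rightarrow> real) \<Rightarrow> nat \<Rightarrow> real" where
  "mom P Y k = (\<integral>\<omega>. Y \<omega> ^ k \<partial>P) / fact k"

definition mom_wd :: "'a measure \<Rightarrow> ('a \<Rightarrow> real) \<Rightarrow> nat \<Rightarrow> bool" where
  "mom_wd P Y k \<longleftrightarrow> integrable P (\<lambda>\<omega>. Y \<omega> ^ k)"

definition momJ :: "'a measure \<Rightarrow> ('a \<Rightarrow> real) \<Rightarrow> nat list \<Rightarrow> real" where
  "momJ P Y J = prod_list (map (mom P Y) J)"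

definition momJ_wd :: "'a measure \<Rightarrow> ('a \<Rightarrow> real) \<Rightarrow> nat list \<Rightarrow> bool" where
  "momJ_wd P Y J \<longleftrightarrow> (\<forall>j\<in>set J. mom_wd P Y j)"

text \<open>
  Multi-indices of length \<open>d\<close> with total at most \<open>m\<close>. There are none for \<open>d > m\<close>, so the sums over
  \<open>d\<close> below stop at \<open>m\<close>.
\<close>

definition mindex :: "nat \<Rightarrow> nat \<Rightarrow> nat list set" where
  "mindex d m = {J. length J = d \<and> (\<forall>j\<in>set J. 1 \<le> j) \<and> sum_list J \<le> m}"

definition delta :: "'a measure \<Rightarrow> nat \<Rightarrow> jet \<Rightarrow> ('a \<Rightarrow> real) \<Rightarrow> ('a \<Rightarrow> real) \<Rightarrow> real" where
  "delta P m f X Y =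
     (\<integral>\<omega>. f 0 (X \<omega> + Y \<omega>) \<partial>P) - (\<Sum>k\<le>m. mom P Y k * (\<integral>\<omega>. f k (X \<omega>) \<partial>P))"

definition delta_wd :: "'a measure \<Rightarrow> nat \<Rightarrow> jet \<Rightarrow> ('a \<Rightarrow> real) \<Rightarrow> ('a \<Rightarrow> real) \<Rightarrow> bool" where
  "delta_wd P m f X Y \<longleftrightarrow>
     integrable P (\<lambda>\<omega>. f 0 (X \<omega> + Y \<omega>)) \<and>
     (\<forall>k\<le>m. mom_wd P Y k \<and> integrable P (\<lambda>\<omega>. f k (X \<omega>)))"

definition eps :: "'a measure \<Rightarrow> nat \<Rightarrow> jet \<Rightarrow> ('a \<Rightarrow> real) \<Rightarrow> ('a \<Rightarrow> real) \<Rightarrow> real" where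
  "eps P m f X Y = - (\<Sum>d=0..m. (-1) ^ d * (\<Sum>J\<in>mindex d m.
     momJ P Y J * delta P (m - sum_list J) (jet_deriv (sum_list J) f) X Y))"

definition eps_wd :: "'a measure \<Rightarrow> nat \<Rightarrow> jet \<Rightarrow> ('a \<Rightarrow> real) \<Rightarrow> ('a \<Rightarrow> real) \<Rightarrow> bool" where
  "eps_wd P m f X Y \<longleftrightarrow> (\<forall>d. \<forall>J\<in>mindex d m.
     momJ_wd P Y J \<and> delta_wd P (m - sum_list J) (jet_deriv (sum_list J) f) X Y)"


section \<open>The expansion\<close>

definition W :: "nat \<Rightarrow> (nat \<Rightarrow> 'a \<Rightarrow> real) \<Rightarrow> 'a \<Rightarrow> real" where
  "W n X \<omega> = (\<Sum>i=1..n. X i \<omega>)"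

definition Wi :: "nat \<Rightarrow> (nat \<Rightarrow> 'a \<Rightarrow> real) \<Rightarrow> nat \<Rightarrow> 'a \<Rightarrow> real" where
  "Wi n X i \<omega> = W n X \<omega> - X i \<omega>"

definition sigmaW :: "'a measure \<Rightarrow> nat \<Rightarrow> (nat \<Rightarrow> 'a \<Rightarrow> real) \<Rightarrow> real" where
  "sigmaW P n X = sqrt (Var P (W n X))"

lemma mindex_decreasing:
  assumes "J \<in> mindex d N" "d \<in> {1..N}"
  shows "N - sum_list J < N"
proof (cases J)
  case Nil
  then show ?thesis using assms by (auto simp: mindex_def)
next
  case (Cons j K)
  then show ?thesis using assms by (auto simp: mindex_def)
qed

text \<open>
  \<open>Xs i\<close> stands for \<open>X\<^sub>i\<^sup>*\<close>. For \<open>N = 0\<close> the sum over \<open>d\<close> in \<open>C_exp\<close> is empty.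
\<close>

function C_exp ::
  "'a measure \<Rightarrow> nat \<Rightarrow> (nat \<Rightarrow> 'a \<Rightarrow> real) \<Rightarrow> (nat \<Rightarrow> 'a \<Rightarrow> real) \<Rightarrow> nat \<Rightarrow> jet \<Rightarrow> real" where
  "C_exp P n X Xs N h = Phi (sigmaW P n X) (h 0) +
     (\<Sum>i=1..n. Var P (X i) * (\<Sum>d=1..N. (-1) ^ (d - 1) * (\<Sum>J\<in>mindex d N.
        momJ P (X i) (butlast J) * (mom P (Xs i) (last J) - mom P (X i) (last J)) *
        C_exp P n X Xs (N - sum_list J)
          (jet_deriv (sum_list J + 1) (stein (sigmaW P n X) h)))))"
  by pat_completeness auto
termination
  by (relation "Wellfounded.measure (\<lambda>(P, n, X, Xs, N, h). N)") (auto dest: mindex_decreasing)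

function e_exp ::
  "'a measure \<Rightarrow> nat \<Rightarrow> (nat \<Rightarrow> 'a \<Rightarrow> real) \<Rightarrow> (nat \<Rightarrow> 'a \<Rightarrow> real) \<Rightarrow> nat \<Rightarrow> jet \<Rightarrow> real" where
  "e_exp P n X Xs N h =
     (if N = 0 then (\<integral>\<omega>. h 0 (W n X \<omega>) \<partial>P) - Phi (sigmaW P n X) (h 0)
      else (\<Sum>i=1..n. Var P (X i) *
        ((\<Sum>d=1..N. (-1) ^ (d - 1) * (\<Sum>J\<in>mindex d N.
            momJ P (X i) (butlast J) * (mom P (Xs i) (last J) - mom P (X i) (last J)) *
            e_exp P n X Xs (N - sum_list J)
              (jet_deriv (sum_list J + 1) (stein (sigmaW P n X) h)))) +
         (\<Sum>k=0..N. eps P (N - k) (jet_deriv (k + 1) (stein (sigmaW P n X) h)) (Wi n X i) (X i) *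
            mom P (Xs i) k) +
         delta P N (jet_deriv 1 (stein (sigmaW P n X) h)) (Wi n X i) (Xs i))))"
  by pat_completeness auto
termination
  by (relation "Wellfounded.measure (\<lambda>(P, n, X, Xs, N, h). N)") (auto dest: mindex_decreasing)

text \<open>All terms of the recursive formulas, at every level of the recursion, are well defined.\<close>

function C_wd ::
  "'a measure \<Rightarrow> nat \<Rightarrow> (nat \<Rightarrow> 'a \<Rightarrow> real) \<Rightarrow> (nat \<Rightarrow> 'a \<Rightarrow> real) \<Rightarrow> nat \<Rightarrow> jet \<Rightarrow> bool" where
  "C_wd P n X Xs N h \<longleftrightarrow>
     Phi_wd (sigmaW P n X) (h 0) \<and>
     (0 < N \<longrightarrow> stein_wd (Suc N) (sigmaW P n X) h) \<and>
     (\<forall>i\<in>{1..n}. \<forall>d\<in>{1..N}. \<forall>J\<in>mindex d N.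
        momJ_wd P (X i) (butlast J) \<and> mom_wd P (Xs i) (last J) \<and> mom_wd P (X i) (last J) \<and>
        C_wd P n X Xs (N - sum_list J)
          (jet_deriv (sum_list J + 1) (stein (sigmaW P n X) h)))"
  by pat_completeness auto
termination
  by (relation "Wellfounded.measure (\<lambda>(P, n, X, Xs, N, h). N)") (auto dest: mindex_decreasing)

function e_wd ::
  "'a measure \<Rightarrow> nat \<Rightarrow> (nat \<Rightarrow> 'a \<Rightarrow> real) \<Rightarrow> (nat \<Rightarrow> 'a \<Rightarrow> real) \<Rightarrow> nat \<Rightarrow> jet \<Rightarrow> bool" where
  "e_wd P n X Xs N h \<longleftrightarrow>
     (if N = 0 then integrable P (\<lambda>\<omega>. h 0 (W n X \<omega>)) \<and> Phi_wd (sigmaW P n X) (h 0)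
      else stein_wd (Suc N) (sigmaW P n X) h \<and>
        (\<forall>i\<in>{1..n}.
           (\<forall>d\<in>{1..N}. \<forall>J\<in>mindex d N.
              momJ_wd P (X i) (butlast J) \<and> mom_wd P (Xs i) (last J) \<and> mom_wd P (X i) (last J) \<and>
              e_wd P n X Xs (N - sum_list J)
                (jet_deriv (sum_list J + 1) (stein (sigmaW P n X) h))) \<and>
           (\<forall>k\<le>N. eps_wd P (N - k) (jet_deriv (k + 1) (stein (sigmaW P n X) h)) (Wi n X i) (X i) \<and>
              mom_wd P (Xs i) k) \<and>
           delta_wd P N (jet_deriv 1 (stein (sigmaW P n X) h)) (Wi n X i) (Xs i)))"
  by pat_completeness auto
termination
  by (relation "Wellfounded.measure (\<lambda>(P, n, X, Xs, N, h). N)") (auto dest: mindex_decreasing)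

declare C_exp.simps [simp del] e_exp.simps [simp del] C_wd.simps [simp del] e_wd.simps [simp del]

end

theory Submission
  imports Defs "HOL-Real_Asymp.Real_Asymp"
begin

text \<open>
  Summing \<open>E X\<^sub>i f(W) = \<sigma>\<^sub>i\<^sup>2 E f'(W\<^sup>(\<^sup>i\<^sup>) + X\<^sub>i\<^sup>*)\<close> over \<open>i\<close>, Stein's equation gives
  \<open>E h(W) - \<Phi>(h) = \<Sum>\<^sub>i \<sigma>\<^sub>i\<^sup>2 (E f'(W\<^sup>(\<^sup>i\<^sup>) + X\<^sub>i\<^sup>*) - E f'(W))\<close>. The first term is expanded around
  \<open>W\<^sup>(\<^sup>i\<^sup>)\<close>, and each \<open>E f\<^sup>(\<^sup>k\<^sup>+\<^sup>1\<^sup>)(W\<^sup>(\<^sup>i\<^sup>))\<close> is re-expanded around \<open>W\<close> by inverting the moment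
  expansion, a telescoping sum whose remainder is \<open>\<epsilon>\<close>. What is left are the expectations
  \<open>E f\<^sup>(\<^sup>|\<^sup>J\<^sup>|\<^sup>+\<^sup>1\<^sup>)(W)\<close>, to which induction applies.

  For the well-definedness, the only property of \<open>h\<close> that has to survive the recursion is that
  \<open>h\<^sup>(\<^sup>N\<^sup>)\<close> grows at most like \<open>|x|\<^sup>q\<close> with \<open>q = \<alpha> + p\<close>. A derivative \<open>u\<close> of the Stein solution satisfies
  \<open>x u - \<sigma>\<^sup>2 u' = g\<close>, and comparison with the barrier \<open>K x\<^sup>r\<^sup>-\<^sup>1\<close> shows that \<open>g = O(|x|\<^sup>r)\<close> implies
  \<open>u = O(|x|\<^sup>r\<^sup>-\<^sup>1)\<close>. So the growth of \<open>f\<^sup>(\<^sup>k\<^sup>)\<close> is one power below that of \<open>h\<^sup>(\<^sup>k\<^sup>)\<close> for \<open>k \<le> N\<close>; in particular \<open>f'\<close> is two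
  powers below \<open>h\<close>, which matches the two moments that \<open>X\<^sub>i\<^sup>*\<close> has less than \<open>X\<^sub>i\<close>.
\<close>

section \<open>Polynomial growth\<close>

text \<open>The weight \<open>1 + \<bar>x\<bar>\<close> is at least 1, so growth is monotone in the
  exponent, and negative exponents, which do occur for Stein solutions, cause no singularity at
  0.\<close>

definition growth :: "real \<Rightarrow> (real \<Rightarrow> real) \<Rightarrow> bool" where
  "growth s u \<longleftrightarrow> (\<exists>C. \<forall>x. \<bar>u x\<bar> \<le> C * (1 + \<bar>x\<bar>) powr s)"

lemma growthI: "(\<And>x. \<bar>u x\<bar> \<le> C * (1 + \<bar>x\<bar>) powr s) \<Longrightarrow> growth s u"
  unfolding growth_def by blast

lemma growthE:
  assumes "growth s u"
  obtains C where "0 \<le> C" "\<And>x. \<bar>u x\<bar> \<le> C * (1 + \<bar>x\<bar>) powr s"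
proof -
  from assms obtain C where C: "\<And>x. \<bar>u x\<bar> \<le> C * (1 + \<bar>x\<bar>) powr s"
    unfolding growth_def by blast
  from C[of 0] have "0 \<le> C" by simp
  with C that show ?thesis by blast
qed

lemma growth_mono:
  assumes "growth s u" "s \<le> t"
  shows "growth t u"
proof -
  from assms(1) obtain C where C: "0 \<le> C" "\<And>x. \<bar>u x\<bar> \<le> C * (1 + \<bar>x\<bar>) powr s"
    by (rule growthE) blast
  have "\<bar>u x\<bar> \<le> C * (1 + \<bar>x\<bar>) powr t" for x
    using C(2)[of x] mult_left_mono[OF powr_mono[OF assms(2), of "1 + \<bar>x\<bar>"] C(1)] by simp
  then show ?thesis by (rule growthI)
qed

lemma growth_add:
  assumes "growth s u" "growth s v"
  shows "growth s (\<lambda>x. u x + v x)"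
proof -
  from assms obtain C D where CD: "\<And>x. \<bar>u x\<bar> \<le> C * (1 + \<bar>x\<bar>) powr s"
    "\<And>x. \<bar>v x\<bar> \<le> D * (1 + \<bar>x\<bar>) powr s"
    unfolding growth_def by blast
  have "\<bar>u x + v x\<bar> \<le> (C + D) * (1 + \<bar>x\<bar>) powr s" for x
    using CD(1)[of x] CD(2)[of x] by (simp add: distrib_right)
  then show ?thesis by (rule growthI)
qed

lemma growth_cmult:
  assumes "growth s u"
  shows "growth s (\<lambda>x. c * u x)"
proof -
  from assms obtain C where C: "\<And>x. \<bar>u x\<bar> \<le> C * (1 + \<bar>x\<bar>) powr s"
    unfolding growth_def by blast
  have "\<bar>c * u x\<bar> \<le> (\<bar>c\<bar> * C) * (1 + \<bar>x\<bar>) powr s" for x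
    using mult_left_mono[OF C[of x] abs_ge_zero[of c]] by (simp add: abs_mult mult.assoc)
  then show ?thesis by (rule growthI)
qed

lemma growth_minus: "growth s u \<Longrightarrow> growth s (\<lambda>x. - u x)"
  using growth_cmult[of s u "-1"] by simp

lemma growth_diff: "growth s u \<Longrightarrow> growth s v \<Longrightarrow> growth s (\<lambda>x. u x - v x)"
  using growth_add[of s u "\<lambda>x. - v x"] growth_minus[of s v] by simp

lemma growth_divide: "growth s u \<Longrightarrow> growth s (\<lambda>x. u x / c)"
  using growth_cmult[of s u "1 / c"] by simp

lemma growth_const: "0 \<le> s \<Longrightarrow> growth s (\<lambda>x. c)"
proof (rule growth_mono)
  show "growth 0 (\<lambda>x. c)" by (rule growthI[where C="\<bar>c\<bar>"]) auto
qed

lemma growth_mult_ident: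
  assumes "growth s u"
  shows "growth (s + 1) (\<lambda>x. x * u x)"
proof -
  from assms obtain C where C: "0 \<le> C" "\<And>x. \<bar>u x\<bar> \<le> C * (1 + \<bar>x\<bar>) powr s"
    by (rule growthE) blast
  have "\<bar>x * u x\<bar> \<le> C * (1 + \<bar>x\<bar>) powr (s + 1)" for x
  proof -
    have "\<bar>x\<bar> * \<bar>u x\<bar> \<le> (1 + \<bar>x\<bar>) * (C * (1 + \<bar>x\<bar>) powr s)"
      by (intro mult_mono C) auto
    then show ?thesis by (simp add: abs_mult powr_add mult.commute mult.left_commute)
  qed
  then show ?thesis by (rule growthI)
qed

lemma growth_reflect: "growth s u \<Longrightarrow> growth s (\<lambda>x. u (- x))"
  unfolding growth_def by (metis abs_minus_cancel)

lemma powr_sum_le: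
  fixes a b :: real
  assumes "0 \<le> a" "0 \<le> b" "0 \<le> s"
  shows "(a + b) powr s \<le> 2 powr s * (a powr s + b powr s)"
proof -
  have "(a + b) powr s \<le> (2 * max a b) powr s"
    using assms by (intro powr_mono2) auto
  also have "\<dots> = 2 powr s * max a b powr s"
    using assms by (simp add: powr_mult)
  also have "max a b powr s \<le> a powr s + b powr s"
    by (auto simp: max_def)
  finally show ?thesis by simp
qed

section \<open>Polynomial growth against Gaussian weights\<close>

lemma normal_density_even: "normal_density 0 \<sigma> (- x) = normal_density 0 \<sigma> x"
  by (simp add: normal_density_def)

lemma normal_density_0_deriv:
  assumes "0 < \<sigma>"
  shows "(normal_density 0 \<sigma> has_real_derivative - (x / \<sigma>\<^sup>2) * normal_density 0 \<sigma> x) (at x)"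
  unfolding normal_density_def using assms
  by (auto intro!: derivative_eq_intros simp: field_simps power2_eq_square)

lemma growth_gaussian_integrable:
  assumes "growth s u" "u \<in> borel_measurable borel" "0 < \<sigma>"
  shows "integrable lborel (\<lambda>x. u x * normal_density 0 \<sigma> x)"
proof -
  from assms(1) obtain C where C: "0 \<le> C" "\<And>x. \<bar>u x\<bar> \<le> C * (1 + \<bar>x\<bar>) powr s"
    by (rule growthE) blast
  \<comment> \<open>The exponent is rounded up to a natural number, so that the absolute moments of
    the normal law provide the majorant.\<close>
  define k where "k = nat \<lceil>\<bar>s\<bar>\<rceil>"
  have sk: "s \<le> real k" unfolding k_def by linarith
  have *: "\<bar>u x\<bar> \<le> C * 2 ^ k * (1 + \<bar>x\<bar> ^ k)" for x
  proof -
    have "(1 + \<bar>x\<bar>) powr s \<le> (1 + \<bar>x\<bar>) powr (real k)" using sk by (intro powr_mono) auto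
    also have "\<dots> \<le> 2 powr real k * (1 powr real k + \<bar>x\<bar> powr real k)"
      by (rule powr_sum_le) auto
    also have "\<dots> \<le> 2 ^ k * (1 + \<bar>x\<bar> ^ k)"
      by (cases "x = 0") (auto simp: powr_realpow)
    finally show ?thesis using C(2)[of x] mult_left_mono[OF _ C(1)] by (fastforce simp: mult.assoc)
  qed
  have "integrable lborel (\<lambda>x. C * 2 ^ k * (normal_density 0 \<sigma> x * \<bar>x - 0\<bar> ^ 0
      + normal_density 0 \<sigma> x * \<bar>x - 0\<bar> ^ k))"
    using assms(3) by (intro integrable_mult_right Bochner_Integration.integrable_add integrable_normal_moment_abs) auto
  then show ?thesis
  proof (rule Bochner_Integration.integrable_bound)
    show "(\<lambda>x. u x * normal_density 0 \<sigma> x) \<in> borel_measurable lborel" using assms(2) by simp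
    show "AE x in lborel. norm (u x * normal_density 0 \<sigma> x) \<le> norm (C * 2 ^ k * (normal_density 0 \<sigma> x * \<bar>x - 0\<bar> ^ 0
      + normal_density 0 \<sigma> x * \<bar>x - 0\<bar> ^ k))"
    proof (rule AE_I2)
      fix x
      have "\<bar>u x\<bar> * normal_density 0 \<sigma> x \<le> C * 2 ^ k * (1 + \<bar>x\<bar> ^ k) * normal_density 0 \<sigma> x"
        by (intro mult_right_mono *) auto
      also have "\<dots> \<le> \<bar>C * 2 ^ k * (normal_density 0 \<sigma> x * \<bar>x - 0\<bar> ^ 0 + normal_density 0 \<sigma> x * \<bar>x - 0\<bar> ^ k)\<bar>"
        by (rule order_trans[OF _ abs_ge_self]) (simp add: algebra_simps)
      finally show "norm (u x * normal_density 0 \<sigma> x) \<le> norm (C * 2 ^ k * (normal_density 0 \<sigma> x * \<bar>x - 0\<bar> ^ 0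
      + normal_density 0 \<sigma> x * \<bar>x - 0\<bar> ^ k))" by (simp add: abs_mult)
    qed
  qed
qed

lemma powr_gaussian_at_top:
  assumes "0 < \<sigma>"
  shows "((\<lambda>x. (1 + \<bar>x\<bar>) powr s * normal_density 0 \<sigma> x) \<longlongrightarrow> 0) at_top"
proof -
  define c where "c = 1 / (2 * \<sigma>\<^sup>2)"
  define K where "K = 1 / sqrt (2 * pi * \<sigma>\<^sup>2)"
  have c: "0 < c" using assms by (simp add: c_def)
  have "((\<lambda>x. K * ((1 + \<bar>x\<bar>) powr s * exp (- (c * x\<^sup>2)))) \<longlongrightarrow> K * 0) at_top"
    using c by (intro tendsto_mult tendsto_const) real_asymp
  then show ?thesis
    by (simp add: normal_density_def c_def K_def mult.commute mult.left_commute)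
qed

lemma growth_gaussian_at_top:
  assumes "growth s u" "0 < \<sigma>"
  shows "((\<lambda>x. u x * normal_density 0 \<sigma> x) \<longlongrightarrow> 0) at_top"
proof -
  from assms(1) obtain C where C: "0 \<le> C" "\<And>x. \<bar>u x\<bar> \<le> C * (1 + \<bar>x\<bar>) powr s"
    by (rule growthE) blast
  show ?thesis
  proof (rule Lim_null_comparison)
    show "((\<lambda>x. C * ((1 + \<bar>x\<bar>) powr s * normal_density 0 \<sigma> x)) \<longlongrightarrow> 0) at_top"
      using tendsto_mult_right_zero[OF powr_gaussian_at_top[OF assms(2), of s]] by simp
    show "\<forall>\<^sub>F x in at_top. norm (u x * normal_density 0 \<sigma> x) \<le> C * ((1 + \<bar>x\<bar>) powr s * normal_density 0 \<sigma> x)"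
      using mult_right_mono[OF C(2) normal_density_nonneg] by (auto simp: abs_mult mult.assoc)
  qed
qed

text \<open>On the compact interval \<open>{-x0..x0}\<close> the function is bounded and the weight
  is bounded away from 0. Growth estimates are thus reduced to large \<open>\<bar>x\<bar>\<close>,
  where the barrier argument works.\<close>

lemma growth_outside:
  assumes cont: "continuous_on UNIV u" and x0: "0 < x0"
    and bnd: "\<And>x. x0 \<le> \<bar>x\<bar> \<Longrightarrow> \<bar>u x\<bar> \<le> K * (1 + \<bar>x\<bar>) powr s"
  shows "growth s u"
proof -
  have "compact (u ` {-x0..x0})"
    by (intro compact_continuous_image continuous_on_subset[OF cont]) auto
  then obtain B where B: "\<And>x. \<bar>x\<bar> \<le> x0 \<Longrightarrow> \<bar>u x\<bar> \<le> B"
    using compact_imp_bounded[THEN bounded_pos[THEN iffD1]] by (fastforce simp: abs_le_iff)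
  \<comment> \<open>The factor \<open>(1 + x0) powr \<bar>s\<bar>\<close> is the reciprocal of a
    lower bound for the weight on \<open>{-x0..x0}\<close>, whatever the sign of
    \<open>s\<close>.\<close>
  define D where "D = max 0 B * (1 + x0) powr \<bar>s\<bar>"
  have "\<bar>u x\<bar> \<le> max D K * (1 + \<bar>x\<bar>) powr s" for x
  proof (cases "x0 \<le> \<bar>x\<bar>")
    case True
    then show ?thesis using bnd[OF True] mult_right_mono[of K "max D K" "(1 + \<bar>x\<bar>) powr s"] by simp
  next
    case False
    have "1 = (1 + \<bar>x\<bar>) powr (- s) * (1 + \<bar>x\<bar>) powr s" by (simp add: powr_add[symmetric])
    also have "\<dots> \<le> (1 + \<bar>x\<bar>) powr \<bar>s\<bar> * (1 + \<bar>x\<bar>) powr s"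
      by (intro mult_right_mono powr_mono) auto
    also have "\<dots> \<le> (1 + x0) powr \<bar>s\<bar> * (1 + \<bar>x\<bar>) powr s"
      using False by (intro mult_right_mono powr_mono2) auto
    finally have 1: "1 \<le> (1 + x0) powr \<bar>s\<bar> * (1 + \<bar>x\<bar>) powr s" .
    have "\<bar>u x\<bar> \<le> max 0 B * 1" using B[of x] False by simp
    also have "\<dots> \<le> max 0 B * ((1 + x0) powr \<bar>s\<bar> * (1 + \<bar>x\<bar>) powr s)"
      by (intro mult_left_mono 1) auto
    also have "\<dots> \<le> max D K * (1 + \<bar>x\<bar>) powr s"
      unfolding D_def mult.assoc[symmetric] by (intro mult_right_mono) auto
    finally show ?thesis .
  qed
  then show ?thesis by (rule growthI)
qed

section \<open>Primitives\<close>

text \<open>The condition that \<open>has_derivs\<close> imposes at the top order, isolated as a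
  relation so that classical derivatives and a top derivative with jumps can be treated
  alike.\<close>

definition prim :: "(real \<Rightarrow> real) \<Rightarrow> (real \<Rightarrow> real) \<Rightarrow> bool" where
  "prim u v \<longleftrightarrow> (\<forall>a b. a \<le> b \<longrightarrow>
     set_integrable lborel {a..b} v \<and> u b - u a = (LINT t:{a..b}|lborel. v t))"

lemma prim_has_integral: "prim u v \<Longrightarrow> a \<le> b \<Longrightarrow> (v has_integral (u b - u a)) {a..b}"
  using set_borel_integral_eq_integral[of "{a..b}" v] unfolding prim_def
  by (metis integrable_integral)

lemma prim_deriv:
  assumes d: "\<And>x. (u has_real_derivative v x) (at x)" and c: "continuous_on UNIV v"
  shows "prim u v"
  unfolding prim_def
proof (intro allI impI conjI)
  fix a b :: real assume ab: "a \<le> b"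
  show "set_integrable lborel {a..b} v"
    by (intro borel_integrable_atLeastAtMost' continuous_on_subset[OF c]) auto
  show "u b - u a = (LINT t:{a..b}|lborel. v t)"
    unfolding set_lebesgue_integral_def
    by (intro integral_FTC_atLeastAtMost[symmetric] ab continuous_on_subset[OF c]
      d[THEN has_real_derivative_iff_has_vector_derivative[THEN iffD1], THEN has_vector_derivative_at_within]) auto
qed

lemma prim_add:
  assumes "prim u v" "prim u' v'"
  shows "prim (\<lambda>x. u x + u' x) (\<lambda>x. v x + v' x)"
  using assms unfolding prim_def by (auto simp: set_integral_add(1) set_integral_add(2) algebra_simps)

lemma prim_cmult:
  assumes "prim u v"
  shows "prim (\<lambda>x. c * u x) (\<lambda>x. c * v x)"
  using assms unfolding prim_def by (auto simp: right_diff_distrib[symmetric])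

lemma prim_continuous:
  assumes "prim u v"
  shows "continuous_on UNIV u"
proof -
  have "continuous_on {a<..<b} u" for a b
  proof (cases "a \<le> b")
    case True
    have "continuous_on {a..b} (\<lambda>x. u a + integral {a..x} v)"
      using prim_has_integral[OF assms True]
      by (intro continuous_intros indefinite_integral_continuous_1) (auto simp: has_integral_integrable)
    moreover have "u a + integral {a..x} v = u x" if "x \<in> {a..b}" for x
      using prim_has_integral[OF assms, of a x] that by (auto simp: integral_unique)
    ultimately have "continuous_on {a..b} u" using continuous_on_eq by blast
    then show ?thesis by (rule continuous_on_subset) auto
  qed auto
  then have "isCont u x" for x
    by (metis continuous_on_eq_continuous_at greaterThanLessThan_iff less_add_one lt_ex open_greaterThanLessThan)
  then show ?thesis by (simp add: continuous_at_imp_continuous_on)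
qed

text \<open>Substitution of \<open>- t\<close> for \<open>t\<close>. Stein's equation keeps its form
  under it, with \<open>- u (- x)\<close> and \<open>g (- x)\<close> in place of \<open>u\<close>
  and \<open>g\<close>, so bounds near minus infinity follow from bounds near plus infinity.\<close>

lemma prim_reflect:
  assumes "prim u v"
  shows "prim (\<lambda>x. - u (- x)) (\<lambda>x. v (- x))"
  unfolding prim_def
proof (intro allI impI)
  fix a b :: real assume ab: "a \<le> b"
  then have *: "set_integrable lborel {-b..-a} v" "u (-a) - u (-b) = (LINT t:{-b..-a}|lborel. v t)"
    using assms unfolding prim_def by auto
  have ind: "indicator {-b..-a} (- x) = (indicator {a..b} x :: real)" for x
    by (auto simp: indicator_def)
  show "set_integrable lborel {a..b} (\<lambda>x. v (- x)) \<and>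
      - u (- b) - - u (- a) = (LINT t:{a..b}|lborel. v (- t))"
    using lborel_integrable_real_affine_iff[of "-1" "\<lambda>x. indicator {-b..-a} x *\<^sub>R v x" 0]
      lborel_integral_real_affine[of "-1" "\<lambda>x. indicator {-b..-a} x *\<^sub>R v x" 0] *
    by (simp add: set_integrable_def set_lebesgue_integral_def ind)
qed

text \<open>\<open>u x - u 0\<close> is an integral over an interval of length
  \<open>\<bar>x\<bar>\<close>. Since \<open>0 \<le> s\<close>, the weight is largest at the
  endpoint \<open>x\<close>, which bounds the integrand.\<close>

lemma prim_growth:
  assumes "prim u v" "growth s v" "0 \<le> s"
  shows "growth (s + 1) u"
proof -
  from assms(2) obtain C where C: "0 \<le> C" "\<And>x. \<bar>v x\<bar> \<le> C * (1 + \<bar>x\<bar>) powr s"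
    by (rule growthE) blast
  have inc: "\<bar>u b - u a\<bar> \<le> C * (1 + c) powr s * (b - a)" if "a \<le> b" "-c \<le> a" "b \<le> c" for a b c
  proof -
    have "norm (u b - u a) \<le> C * (1 + c) powr s * measure lborel (cbox a b)"
    proof (rule has_integral_bound)
      show "(v has_integral (u b - u a)) (cbox a b)" using prim_has_integral[OF assms(1) that(1)] by simp
      show "norm (v x) \<le> C * (1 + c) powr s" if "x \<in> cbox a b" for x
        using C(2)[of x] \<open>-c \<le> a\<close> \<open>b \<le> c\<close> that C(1) assms(3)
        by (auto intro!: order_trans[OF C(2)] mult_left_mono powr_mono2)
    qed (use C in auto)
    then show ?thesis using that by simp
  qed
  have "\<bar>u x\<bar> \<le> (\<bar>u 0\<bar> + C) * (1 + \<bar>x\<bar>) powr (s + 1)" for x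
  proof -
    have "\<bar>u x - u 0\<bar> \<le> C * (1 + \<bar>x\<bar>) powr s * \<bar>x\<bar>"
      using inc[of 0 x "\<bar>x\<bar>"] inc[of x 0 "\<bar>x\<bar>"] by (cases "0 \<le> x") (auto simp: abs_minus_commute)
    also have "\<dots> \<le> C * (1 + \<bar>x\<bar>) powr s * (1 + \<bar>x\<bar>)"
      using C by (intro mult_left_mono) auto
    finally have "\<bar>u x - u 0\<bar> \<le> C * (1 + \<bar>x\<bar>) powr (s + 1)" by (simp add: powr_add mult.assoc)
    moreover have "\<bar>u 0\<bar> * 1 \<le> \<bar>u 0\<bar> * (1 + \<bar>x\<bar>) powr (s + 1)"
      using assms(3) by (intro mult_left_mono ge_one_powr_ge_zero) auto
    ultimately show ?thesis by (simp add: distrib_right)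
  qed
  then show ?thesis by (rule growthI)
qed

section \<open>Antiderivatives and a barrier for Stein's equation\<close>

lemma continuous_antiderivative:
  fixes g :: "real \<Rightarrow> real"
  assumes "continuous_on UNIV g"
  obtains G where "\<And>x. (G has_real_derivative g x) (at x)"
proof -
  have "\<exists>F. \<forall>x::real. -\<infinity> < ereal x \<longrightarrow> ereal x < \<infinity> \<longrightarrow> (F has_vector_derivative g x) (at x)"
    using assms by (intro einterval_antiderivative) (auto simp: continuous_on_eq_continuous_at)
  then show ?thesis using that by (auto simp: has_real_derivative_iff_has_vector_derivative)
qed

text \<open>In terms of increments, the hypotheses say
  \<open>Z' \<ge> x Z / \<sigma>\<^sup>2\<close>. For differentiable \<open>Z\<close> this makes
  \<open>Z\<close> times the normal density nondecreasing, and a nondecreasing function with limit 0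
  is nonpositive.\<close>

lemma stein_comparison:
  assumes \<sigma>: "0 < \<sigma>" and x0: "0 \<le> x0"
    and G: "\<And>x. (G has_real_derivative G' x) (at x)"
    and G': "\<And>x. x0 \<le> x \<Longrightarrow> G' x = x * Z x / \<sigma>\<^sup>2"
    and Z: "\<And>a b. x0 \<le> a \<Longrightarrow> a \<le> b \<Longrightarrow> G b - G a \<le> Z b - Z a"
    and lim: "((\<lambda>x. Z x * normal_density 0 \<sigma> x) \<longlongrightarrow> 0) at_top"
    and a: "x0 \<le> a"
  shows "Z a \<le> 0"
proof -
  \<comment> \<open>\<open>Z\<close> itself need not be differentiable. On \<open>{a..}\<close>,
    \<open>R\<close> is a differentiable minorant of \<open>Z\<close> that agrees with it at
    \<open>a\<close>, and it carries the monotonicity argument.\<close>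
  define R where "R x = Z a + G x - G a" for x
  define \<phi> where "\<phi> = normal_density 0 \<sigma>"
  have pos: "0 < \<phi> x" for x using \<sigma> by (simp add: \<phi>_def normal_density_pos)
  have RZ: "R x \<le> Z x" if "a \<le> x" for x using Z[OF a that] by (simp add: R_def)
  have "R a * \<phi> a \<le> R b * \<phi> b" if ab: "a \<le> b" for b
  proof (rule DERIV_nonneg_imp_nondecreasing[OF ab])
    fix x assume x: "a \<le> x" "x \<le> b"
    have "((\<lambda>x. R x * \<phi> x) has_real_derivative
        G' x * \<phi> x + (- (x / \<sigma>\<^sup>2) * \<phi> x) * R x) (at x)"
      unfolding R_def \<phi>_def
      by (rule DERIV_mult[OF _ normal_density_0_deriv[OF \<sigma>]]) (auto intro!: derivative_eq_intros G)
    moreover have "G' x * \<phi> x + (- (x / \<sigma>\<^sup>2) * \<phi> x) * R x = x / \<sigma>\<^sup>2 * \<phi> x * (Z x - R x)"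
      using G'[of x] x a \<sigma> by (simp add: field_simps)
    moreover have "0 \<le> x / \<sigma>\<^sup>2 * \<phi> x * (Z x - R x)"
      using RZ[of x] x a x0 pos[of x] by (intro mult_nonneg_nonneg) auto
    ultimately show "\<exists>y. ((\<lambda>x. R x * \<phi> x) has_real_derivative y) (at x) \<and> 0 \<le> y" by metis
  qed
  then have *: "Z a * \<phi> a \<le> Z b * \<phi> b" if "a \<le> b" for b
    using order_trans[OF _ mult_right_mono[OF RZ less_imp_le[OF pos]]] that by (simp add: R_def)
  have "Z a * \<phi> a \<le> 0"
    by (rule tendsto_lowerbound[OF lim[folded \<phi>_def]]) (use * in \<open>auto intro!: eventually_at_top_linorderI\<close>)
  then show ?thesis using pos[of a] by (simp add: mult_le_0_iff)
qed

text \<open>With \<open>B y = K * y powr (r - 1)\<close>, the difference \<open>u - B\<close>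
  satisfies the inequality of \<open>stein_comparison\<close> once
  \<open>g y \<le> y * B y - \<sigma>\<^sup>2 * B' y\<close>. Beyond the threshold,
  \<open>\<sigma>\<^sup>2 * (r - 1) \<le> y\<^sup>2 / 2\<close>, so the right side is at least
  \<open>K * y powr r / 2\<close>. As \<open>1 + y \<le> 2 * y\<close> there, this \<open>K\<close>
  is just large enough to dominate \<open>C * (1 + y) powr r\<close>.\<close>

lemma stein_upper_barrier:
  assumes \<sigma>: "0 < \<sigma>" and u: "prim u (\<lambda>x. (x * u x - g x) / \<sigma>\<^sup>2)"
    and lim: "((\<lambda>x. u x * normal_density 0 \<sigma> x) \<longlongrightarrow> 0) at_top"
    and g: "\<And>x. \<bar>g x\<bar> \<le> C * (1 + \<bar>x\<bar>) powr r" and r: "0 \<le> r" and C: "0 \<le> C"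
    and x: "1 + 2 * \<sigma>\<^sup>2 * \<bar>r - 1\<bar> \<le> x"
  shows "u x \<le> 2 * C * 2 powr r * x powr (r - 1)"
proof -
  define K where "K = 2 * C * 2 powr r"
  define x0 where "x0 = 1 + 2 * \<sigma>\<^sup>2 * \<bar>r - 1\<bar>"
  define s where "s = r - 1"
  have x0: "1 \<le> x0" by (simp add: x0_def)
  have K: "0 \<le> K" using C by (simp add: K_def)
  (* Clamping at x0 makes the barrier continuous on the whole line. *)
  define Z where "Z y = u y - K * max x0 y powr s" for y
  have cu: "continuous_on UNIV u" using prim_continuous[OF u] .
  have cZ: "continuous_on UNIV Z" unfolding Z_def using x0
    by (intro continuous_intros cu) auto
  obtain G where G: "\<And>y. (G has_real_derivative y * Z y / \<sigma>\<^sup>2) (at y)"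
    by (rule continuous_antiderivative[of "\<lambda>y. y * Z y / \<sigma>\<^sup>2"]) (use \<sigma> in \<open>auto intro!: continuous_intros cZ\<close>)
  have "Z x \<le> 0"
  proof (rule stein_comparison[where Z=Z and a=x, OF \<sigma> _ G])
    show "0 \<le> x0" using x0 by simp
    show "y * Z y / \<sigma>\<^sup>2 = y * Z y / \<sigma>\<^sup>2" for y ..
    show "x0 \<le> x" using x by (simp add: x0_def)
    have "((\<lambda>y. u y * normal_density 0 \<sigma> y - K * (y powr s * normal_density 0 \<sigma> y)) \<longlongrightarrow> 0 - K * 0) at_top"
    proof (intro tendsto_diff lim tendsto_mult tendsto_const)
      have "((\<lambda>y. (1 + \<bar>y\<bar>) powr \<bar>s\<bar> * normal_density 0 \<sigma> y) \<longlongrightarrow> 0) at_top"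
        by (rule powr_gaussian_at_top[OF \<sigma>])
      then show "((\<lambda>y. y powr s * normal_density 0 \<sigma> y) \<longlongrightarrow> 0) at_top"
      proof (rule Lim_null_comparison[rotated])
        have "y powr s \<le> (1 + \<bar>y\<bar>) powr \<bar>s\<bar>" if "1 \<le> y" for y
          using order_trans[OF powr_mono[of s "\<bar>s\<bar>" y] powr_mono2[of "\<bar>s\<bar>" y "1 + \<bar>y\<bar>"]] that by auto
        then show "\<forall>\<^sub>F y in at_top. norm (y powr s * normal_density 0 \<sigma> y) \<le> (1 + \<bar>y\<bar>) powr \<bar>s\<bar> * normal_density 0 \<sigma> y"
          unfolding eventually_at_top_linorder
          by (intro exI[of _ 1] allI impI) (simp add: abs_mult mult_right_mono)
      qed
    qed
    moreover have "\<forall>\<^sub>F y in at_top. u y * normal_density 0 \<sigma> y - K * (y powr s * normal_density 0 \<sigma> y)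
        = Z y * normal_density 0 \<sigma> y"
      using eventually_ge_at_top[of x0] by eventually_elim (simp add: Z_def left_diff_distrib)
    ultimately show "((\<lambda>y. Z y * normal_density 0 \<sigma> y) \<longlongrightarrow> 0) at_top"
      using Lim_transform_eventually by fastforce
    fix a b assume ab: "x0 \<le> a" "a \<le> b"
    define B where "B y = K * y powr s" for y
    define B' where "B' y = K * (s * y powr (s - 1))" for y
    have dB: "(B has_real_derivative B' y) (at y)" if "a \<le> y" for y
      unfolding B_def B'_def using that ab x0 by (intro DERIV_cmult has_real_derivative_powr) auto
    have 1: "((\<lambda>y. y * Z y / \<sigma>\<^sup>2 + B' y) has_integral (G b + B b - (G a + B a))) {a..b}"
    proof (rule fundamental_theorem_of_calculus[OF ab(2)])
      fix y assume "y \<in> {a..b}"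
      then show "((\<lambda>y. G y + B y) has_vector_derivative y * Z y / \<sigma>\<^sup>2 + B' y) (at y within {a..b})"
        by (intro DERIV_add[OF G dB, THEN has_real_derivative_iff_has_vector_derivative[THEN iffD1],
          THEN has_vector_derivative_at_within]) simp
    qed
    have 2: "((\<lambda>x. (x * u x - g x) / \<sigma>\<^sup>2) has_integral (u b - u a)) {a..b}"
      by (rule prim_has_integral[OF u ab(2)])
    have "G b + B b - (G a + B a) \<le> u b - u a"
    proof (rule has_integral_le[OF 1 2])
      fix y assume "y \<in> {a..b}"
      then have y: "x0 \<le> y" "1 \<le> y" using ab x0 by auto
      have "\<sigma>\<^sup>2 * s \<le> y\<^sup>2 / 2"
      proof -
        have "2 * (\<sigma>\<^sup>2 * s) \<le> x0" unfolding x0_def s_def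
          using mult_left_mono[OF abs_ge_self[of "r - 1"], of "2 * \<sigma>\<^sup>2"] by (simp add: mult.assoc)
        also have "\<dots> \<le> y" by fact
        also have "\<dots> \<le> y\<^sup>2" using y by (simp add: power2_eq_square)
        finally show ?thesis by simp
      qed
      then have k1: "\<sigma>\<^sup>2 * s * y powr (s - 1) \<le> y\<^sup>2 / 2 * y powr (s - 1)"
        by (rule mult_right_mono) auto
      have k2: "y\<^sup>2 * y powr (s - 1) = y * y powr s"
        using y by (simp add: powr_diff power2_eq_square)
      have k3: "y * y powr s = y powr r"
        using y by (simp add: s_def powr_diff)
      have "g y \<le> C * (1 + \<bar>y\<bar>) powr r" using g[of y] by simp
      also have "\<dots> \<le> C * (2 * y) powr r" using y r C by (intro mult_left_mono powr_mono2) auto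
      also have "\<dots> = K * (y powr r / 2)" using y by (simp add: K_def powr_mult)
      also have "\<dots> \<le> K * (y * y powr s - \<sigma>\<^sup>2 * s * y powr (s - 1))"
        using k1 k2 k3 by (intro mult_left_mono K) auto
      finally have "y * Z y + \<sigma>\<^sup>2 * B' y \<le> y * u y - g y"
        using y by (simp add: Z_def B'_def algebra_simps)
      then have "(y * Z y + \<sigma>\<^sup>2 * B' y) / \<sigma>\<^sup>2 \<le> (y * u y - g y) / \<sigma>\<^sup>2"
        by (rule divide_right_mono) simp
      then show "y * Z y / \<sigma>\<^sup>2 + B' y \<le> (y * u y - g y) / \<sigma>\<^sup>2"
        using \<sigma> by (simp add: add_divide_distrib)
    qed
    then show "G b - G a \<le> Z b - Z a" using ab by (simp add: Z_def B_def max_def)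
  qed
  then show ?thesis using x by (simp add: Z_def K_def x0_def s_def max_def)
qed

text \<open>The upper barrier is applied to \<open>u\<close>, to \<open>- u\<close> and to the
  reflections of both. The two limits exclude the homogeneous solutions, which are the multiples of
  \<open>1 / normal_density 0 \<sigma>\<close>.\<close>

lemma stein_growth:
  assumes \<sigma>: "0 < \<sigma>" and u: "prim u (\<lambda>x. (x * u x - g x) / \<sigma>\<^sup>2)"
    and top: "((\<lambda>x. u x * normal_density 0 \<sigma> x) \<longlongrightarrow> 0) at_top"
    and bot: "((\<lambda>x. u (- x) * normal_density 0 \<sigma> x) \<longlongrightarrow> 0) at_top"
    and g: "growth r g" and r: "0 \<le> r"
  shows "growth (r - 1) u"
proof -
  from g obtain C where C: "0 \<le> C" "\<And>x. \<bar>g x\<bar> \<le> C * (1 + \<bar>x\<bar>) powr r"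
    by (rule growthE) blast
  define x0 where "x0 = 1 + 2 * \<sigma>\<^sup>2 * \<bar>r - 1\<bar>"
  have x0: "1 \<le> x0" by (simp add: x0_def)
  define K where "K = 2 * C * 2 powr r"
  have K: "0 \<le> K" using C by (simp add: K_def)
  have nu: "prim (\<lambda>x. - u x) (\<lambda>x. (x * (- u x) - (- g x)) / \<sigma>\<^sup>2)"
    using prim_cmult[OF u, of "-1"] by (simp add: diff_divide_distrib)
  have ru: "prim (\<lambda>x. - u (- x)) (\<lambda>x. (x * (- u (- x)) - g (- x)) / \<sigma>\<^sup>2)"
    using prim_reflect[OF u] by simp
  have nru: "prim (\<lambda>x. u (- x)) (\<lambda>x. (x * u (- x) - (- g (- x))) / \<sigma>\<^sup>2)"
    using prim_reflect[OF nu] by simp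
  have *: "\<bar>u x\<bar> \<le> K * \<bar>x\<bar> powr (r - 1)" if "x0 \<le> \<bar>x\<bar>" for x
  proof (cases "0 \<le> x")
    case True
    then have x: "1 + 2 * \<sigma>\<^sup>2 * \<bar>r - 1\<bar> \<le> x" using that by (simp add: x0_def)
    show ?thesis
      using stein_upper_barrier[OF \<sigma> u top C(2) r C(1) x]
        stein_upper_barrier[OF \<sigma> nu _ _ r C(1) x] tendsto_minus[OF top] C(2) True by (auto simp: K_def)
  next
    case False
    then have x: "1 + 2 * \<sigma>\<^sup>2 * \<bar>r - 1\<bar> \<le> - x" using that by (simp add: x0_def)
    show ?thesis
      using stein_upper_barrier[OF \<sigma> ru _ _ r C(1) x] C(2)[of "- _"]
        stein_upper_barrier[OF \<sigma> nru bot _ r C(1) x] tendsto_minus[OF bot] False by (auto simp: K_def)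
  qed
  show ?thesis
  proof (rule growth_outside)
    show "continuous_on UNIV u" by (rule prim_continuous[OF u])
    show "0 < x0" using x0 by simp
    fix x assume x: "x0 \<le> \<bar>x\<bar>"
    have x1: "1 \<le> \<bar>x\<bar>" using x x0 by simp
    \<comment> \<open>The exponent may be negative, so monotonicity is used for \<open>r\<close>
      only; the remaining factor is handled by
      \<open>1 / \<bar>x\<bar> \<le> 2 / (1 + \<bar>x\<bar>)\<close> for
      \<open>1 \<le> \<bar>x\<bar>\<close>.\<close>
    have "\<bar>x\<bar> powr (r - 1) \<le> 2 * (1 + \<bar>x\<bar>) powr (r - 1)"
    proof -
      have "\<bar>x\<bar> powr (r - 1) = \<bar>x\<bar> powr r / \<bar>x\<bar>" using x1 by (simp add: powr_diff)
      also have "\<dots> \<le> (1 + \<bar>x\<bar>) powr r / \<bar>x\<bar>"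
        using r by (intro divide_right_mono powr_mono2) auto
      also have "\<dots> \<le> (1 + \<bar>x\<bar>) powr r * (2 / (1 + \<bar>x\<bar>))"
        unfolding divide_inverse using x1 by (intro mult_left_mono) (auto simp: field_simps)
      also have "\<dots> = 2 * (1 + \<bar>x\<bar>) powr (r - 1)" by (simp add: powr_diff)
      finally show ?thesis .
    qed
    then show "\<bar>u x\<bar> \<le> (K * 2) * (1 + \<bar>x\<bar>) powr (r - 1)"
      using *[OF x] mult_left_mono[OF _ K] by (fastforce simp: mult.assoc)
  qed
qed

section \<open>Test functions and Stein's equation\<close>

text \<open>The invariant of the recursion. Measurability is demanded at the top order only, since
  the lower entries turn out to be continuous.\<close>

definition jet_class :: "nat \<Rightarrow> real \<Rightarrow> jet \<Rightarrow> bool" where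
  "jet_class N q h \<longleftrightarrow> has_derivs N h \<and> h N \<in> borel_measurable borel \<and> growth q (h N)"

text \<open>Below the top order the next derivative is continuous, being either differentiable or a
  primitive of the top one, so the fundamental theorem of calculus applies.\<close>

lemma jet_class_prim:
  assumes "jet_class N q h" "k < N"
  shows "prim (h k) (h (Suc k))"
proof (cases "Suc k = N")
  case True
  then show ?thesis using assms unfolding jet_class_def has_derivs_def prim_def by auto
next
  case False
  then have k: "Suc k < N" using assms(2) by simp
  have d: "(h j has_real_derivative h (Suc j) x) (at x)" if "Suc j < N" for j x
    using assms(1) that unfolding jet_class_def has_derivs_def by auto
  have "continuous_on UNIV (h (Suc k))"
  proof (cases "Suc (Suc k) = N")
    case True
    then have "prim (h (Suc k)) (h N)"
      using assms unfolding jet_class_def has_derivs_def prim_def by auto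
    then show ?thesis by (rule prim_continuous)
  next
    case False
    then have "Suc (Suc k) < N" using k by simp
    from d[OF this] show ?thesis
      by (meson DERIV_continuous continuous_at_imp_continuous_on)
  qed
  with d[OF k] show ?thesis by (rule prim_deriv)
qed

lemma jet_class_continuous: "jet_class N q h \<Longrightarrow> k < N \<Longrightarrow> continuous_on UNIV (h k)"
  by (rule prim_continuous[OF jet_class_prim])

lemma jet_class_measurable: "jet_class N q h \<Longrightarrow> k \<le> N \<Longrightarrow> h k \<in> borel_measurable borel"
  using jet_class_continuous[of N q h k] borel_measurable_continuous_onI
  by (cases "k = N") (auto simp: jet_class_def)

text \<open>Downward induction from the top order: each integration costs one power.\<close>

lemma jet_class_growth:
  assumes "jet_class N q h" "0 \<le> q" "k \<le> N"
  shows "growth (real (N - k) + q) (h k)"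
  using assms(3)
proof (induction k rule: inc_induct)
  case base
  then show ?case using assms(1) by (simp add: jet_class_def)
next
  case (step k)
  have "growth (real (N - Suc k) + q + 1) (h k)"
    using step assms by (intro prim_growth[OF jet_class_prim]) auto
  moreover have "real (N - Suc k) + q + 1 = real (N - k) + q"
    using step by (simp add: of_nat_diff)
  ultimately show ?case by (simp only:)
qed

section \<open>Gaussian expectations and tail integrals\<close>

lemma Phi_integrable_iff:
  assumes "u \<in> borel_measurable borel"
  shows "Phi_wd \<sigma> u \<longleftrightarrow> integrable lborel (\<lambda>x. u x * normal_density 0 \<sigma> x)"
  using assms unfolding Phi_wd_def by (subst integrable_density) (auto simp: mult.commute)

lemma Phi_eq:
  assumes "u \<in> borel_measurable borel"
  shows "Phi \<sigma> u = (\<integral>x. u x * normal_density 0 \<sigma> x \<partial>lborel)"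
  using assms unfolding Phi_def by (subst integral_density) (auto simp: mult.commute)

lemma Phi_wd_growth:
  "growth s u \<Longrightarrow> u \<in> borel_measurable borel \<Longrightarrow> 0 < \<sigma> \<Longrightarrow> Phi_wd \<sigma> u"
  by (simp add: Phi_integrable_iff growth_gaussian_integrable)

lemma set_integral_atLeast_at_top:
  fixes g :: "real \<Rightarrow> real"
  assumes "integrable lborel g"
  shows "((\<lambda>x. LINT t:{x..}|lborel. g t) \<longlongrightarrow> 0) at_top"
proof -
  have "((\<lambda>x. \<integral>t. indicator {x..} t *\<^sub>R g t \<partial>lborel) \<longlongrightarrow> integral\<^sup>L lborel (\<lambda>t::real. 0::real)) at_top"
  proof (rule integral_dominated_convergence_at_top[where w="\<lambda>t. norm (g t)"])
    show "AE t in lborel. ((\<lambda>x. indicator {x..} t *\<^sub>R g t) \<longlongrightarrow> 0) at_top"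
    proof (rule AE_I2)
      fix t
      show "((\<lambda>x. indicator {x..} t *\<^sub>R g t) \<longlongrightarrow> 0) at_top"
        using eventually_gt_at_top[of t]
        by (intro tendsto_eventually) (elim eventually_mono, simp add: indicator_def)
    qed
  qed (use assms in \<open>auto simp: indicator_def\<close>)
  then show ?thesis by (simp add: set_lebesgue_integral_def)
qed

lemma set_integral_atLeast_at_bot:
  fixes g :: "real \<Rightarrow> real"
  assumes "integrable lborel g"
  shows "((\<lambda>x. LINT t:{-x..}|lborel. g t) \<longlongrightarrow> (\<integral>t. g t \<partial>lborel)) at_top"
proof -
  have "((\<lambda>x. \<integral>t. indicator {-x..} t *\<^sub>R g t \<partial>lborel) \<longlongrightarrow> (\<integral>t. g t \<partial>lborel)) at_top"
  proof (rule integral_dominated_convergence_at_top[where w="\<lambda>t. norm (g t)"])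
    show "AE t in lborel. ((\<lambda>x. indicator {-x..} t *\<^sub>R g t) \<longlongrightarrow> g t) at_top"
    proof (rule AE_I2)
      fix t
      show "((\<lambda>x. indicator {-x..} t *\<^sub>R g t) \<longlongrightarrow> g t) at_top"
        using eventually_ge_at_top[of "-t"]
        by (intro tendsto_eventually) (elim eventually_mono, simp add: indicator_def)
    qed
  qed (use assms in \<open>auto simp: indicator_def\<close>)
  then show ?thesis by (simp add: set_lebesgue_integral_def)
qed

text \<open>For an antiderivative \<open>G\<close> of \<open>g\<close>, the tail integral plus
  \<open>G\<close> is constant.\<close>

lemma set_integral_atLeast_deriv:
  fixes g :: "real \<Rightarrow> real"
  assumes g: "integrable lborel g" and c: "continuous_on UNIV g"
  shows "((\<lambda>x. LINT t:{x..}|lborel. g t) has_real_derivative - g x) (at x)"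
proof -
  obtain G where G: "\<And>x. (G has_real_derivative g x) (at x)"
    by (rule continuous_antiderivative[OF c]) blast
  have p: "prim G g" by (rule prim_deriv[OF G c])
  have si: "set_integrable lborel {a..} g" for a
    unfolding set_integrable_def using g by (rule integrable_mult_indicator[rotated]) simp
  have *: "(LINT t:{a..}|lborel. g t) + G a = (LINT t:{b..}|lborel. g t) + G b" if "a \<le> b" for a b
  proof -
    have "(LINT t:{a..}|lborel. g t) = (LINT t:{a..<b} \<union> {b..}|lborel. g t)"
      using that by (simp add: ivl_disj_un)
    also have "\<dots> = (LINT t:{a..<b}|lborel. g t) + (LINT t:{b..}|lborel. g t)"
      by (intro set_integral_Un set_integrable_subset[OF si[of a]] si) auto
    also have "(LINT t:{a..<b}|lborel. g t) = (LINT t:{a..b}|lborel. g t)"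
      unfolding set_lebesgue_integral_def
      by (intro integral_cong_AE) (use g AE_lborel_singleton[of b] in \<open>auto elim!: eventually_mono simp: indicator_def\<close>)
    also have "\<dots> = G b - G a" using p that by (simp add: prim_def)
    finally show ?thesis by simp
  qed
  define c where "c = (LINT t:{0..}|lborel. g t) + G 0"
  have "(LINT t:{x..}|lborel. g t) = c - G x" for x
  proof (cases "0 \<le> x")
    case True
    from *[OF this] show ?thesis unfolding c_def by linarith
  next
    case False
    then have "x \<le> 0" by simp
    from *[OF this] show ?thesis unfolding c_def by linarith
  qed
  then show ?thesis using DERIV_diff[OF DERIV_const[of c] G[of x]] by simp
qed

declare stein.simps [simp del]

section \<open>Regularity and growth of the Stein solution\<close>

context
  fixes N :: nat and q \<sigma> :: real and h :: jet
  assumes N: "1 \<le> N" and q: "0 \<le> q" and \<sigma>: "0 < \<sigma>" and h: "jet_class N q h"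
begin

lemma h0_continuous: "continuous_on UNIV (h 0)"
  using jet_class_continuous[OF h, of 0] N by simp

lemma h0_centered_growth: "growth (real N + q) (\<lambda>x. h 0 x - Phi \<sigma> (h 0))"
  using jet_class_growth[OF h q, of 0] q by (intro growth_diff growth_const) auto

lemma h0_centered_integrable:
  "integrable lborel (\<lambda>t. (h 0 t - Phi \<sigma> (h 0)) * normal_density 0 \<sigma> t)"
  by (rule growth_gaussian_integrable[OF h0_centered_growth _ \<sigma>])
    (use borel_measurable_continuous_onI[OF h0_continuous] in measurable)

text \<open>Centring makes the tail integral in the Stein solution vanish at minus infinity as well
  as at plus infinity.\<close>

lemma h0_centered_integral:
  "(\<integral>t. (h 0 t - Phi \<sigma> (h 0)) * normal_density 0 \<sigma> t \<partial>lborel) = 0"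
proof -
  have m: "h 0 \<in> borel_measurable borel" by (rule borel_measurable_continuous_onI[OF h0_continuous])
  have "integrable lborel (\<lambda>x. h 0 x * normal_density 0 \<sigma> x)"
    by (rule growth_gaussian_integrable[OF jet_class_growth[OF h q, of 0] m \<sigma>]) simp
  then show ?thesis
    by (simp add: left_diff_distrib Phi_eq[OF m] integral_normal_density[OF \<sigma>] integrable_normal_density[OF \<sigma>])
qed

lemma stein_0_gaussian:
  "stein \<sigma> h 0 x * normal_density 0 \<sigma> x =
     (LINT t:{x..}|lborel. (h 0 t - Phi \<sigma> (h 0)) * normal_density 0 \<sigma> t) / \<sigma>\<^sup>2"
  using normal_density_pos[OF \<sigma>, of 0 x] \<sigma> by (simp add: stein.simps field_simps)

text \<open>The quotient rule applies classically, because \<open>h 0\<close> is continuous for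
  \<open>1 \<le> N\<close>. The logarithmic derivative \<open>- x / \<sigma>\<^sup>2\<close> of the
  density produces the term \<open>x * stein \<sigma> h 0 x\<close>.\<close>

lemma stein_0_deriv: "(stein \<sigma> h 0 has_real_derivative stein \<sigma> h 1 x) (at x)"
proof -
  define \<phi> where "\<phi> = normal_density 0 \<sigma>"
  define I where "I x = (LINT t:{x..}|lborel. (h 0 t - Phi \<sigma> (h 0)) * \<phi> t)" for x
  have pos: "0 < \<phi> x" for x using \<sigma> by (simp add: \<phi>_def normal_density_pos)
  have dphi: "(\<phi> has_real_derivative - (x / \<sigma>\<^sup>2) * \<phi> x) (at x)" for x
    unfolding \<phi>_def by (rule normal_density_0_deriv[OF \<sigma>])
  have "continuous_on UNIV \<phi>"
    using dphi DERIV_continuous continuous_at_imp_continuous_on by blast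
  then have dI: "(I has_real_derivative - ((h 0 x - Phi \<sigma> (h 0)) * \<phi> x)) (at x)"
    unfolding I_def
    by (intro set_integral_atLeast_deriv h0_centered_integrable[folded \<phi>_def] continuous_intros h0_continuous)
  have f: "stein \<sigma> h 0 = (\<lambda>x. I x / (\<sigma>\<^sup>2 * \<phi> x))"
    by (auto simp: stein.simps I_def \<phi>_def)
  have "((\<lambda>x. I x / (\<sigma>\<^sup>2 * \<phi> x)) has_real_derivative
      (- ((h 0 x - Phi \<sigma> (h 0)) * \<phi> x) * (\<sigma>\<^sup>2 * \<phi> x) - I x * (\<sigma>\<^sup>2 * (- (x / \<sigma>\<^sup>2) * \<phi> x)))
        / ((\<sigma>\<^sup>2 * \<phi> x) * (\<sigma>\<^sup>2 * \<phi> x))) (at x)" (is "(_ has_real_derivative ?D) _")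
    using \<sigma> pos[of x] by (intro DERIV_divide dI DERIV_cmult dphi) auto
  moreover have "?D = (x * (I x / (\<sigma>\<^sup>2 * \<phi> x)) - (h 0 x - Phi \<sigma> (h 0))) / \<sigma>\<^sup>2"
    using \<sigma> pos[of x] by (simp add: field_simps)
  ultimately show ?thesis by (simp only: f One_nat_def stein.simps(2))
qed

text \<open>The recursion defining \<open>stein\<close> is differentiated. It reaches back two
  orders, hence the strong induction; order 1 is separate because its formula contains
  \<open>Phi\<close> instead of a lower derivative.\<close>

lemma stein_deriv: "k < N \<Longrightarrow> (stein \<sigma> h k has_real_derivative stein \<sigma> h (Suc k) x) (at x)"
proof (induction k arbitrary: x rule: less_induct)
  case (less k)
  have dh: "(h j has_real_derivative h (Suc j) x) (at x)" if "Suc j < N" for j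
    using h that unfolding jet_class_def has_derivs_def by auto
  consider "k = 0" | "k = 1" | l where "k = Suc (Suc l)"
    by (metis One_nat_def not0_implies_Suc)
  then show ?case
  proof cases
    case 1
    then show ?thesis using stein_0_deriv by simp
  next
    case 2
    have e: "stein \<sigma> h (Suc 0) = (\<lambda>x. (x * stein \<sigma> h 0 x - (h 0 x - Phi \<sigma> (h 0))) / \<sigma>\<^sup>2)" by (rule ext) (rule stein.simps)
    have "((\<lambda>x. (x * stein \<sigma> h 0 x - (h 0 x - Phi \<sigma> (h 0))) / \<sigma>\<^sup>2) has_real_derivative
        ((1 * stein \<sigma> h 0 x + stein \<sigma> h 1 x * x) - (h 1 x - 0)) / \<sigma>\<^sup>2) (at x)"
      using less.prems 2 dh[of 0]
      by (intro DERIV_cdivide DERIV_diff DERIV_mult DERIV_ident DERIV_const stein_0_deriv) auto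
    moreover have "((1 * stein \<sigma> h 0 x + stein \<sigma> h 1 x * x) - (h 1 x - 0)) / \<sigma>\<^sup>2 = stein \<sigma> h (Suc (Suc 0)) x"
      by (simp add: stein.simps mult.commute add.commute)
    ultimately show ?thesis unfolding 2 One_nat_def e by (simp only:)
  next
    case 3
    have e: "stein \<sigma> h k = (\<lambda>x. (x * stein \<sigma> h (Suc l) x + real (Suc l) * stein \<sigma> h l x - h (Suc l) x) / \<sigma>\<^sup>2)"
      unfolding 3 by (rule ext) (rule stein.simps)
    have "((\<lambda>x. (x * stein \<sigma> h (Suc l) x + real (Suc l) * stein \<sigma> h l x - h (Suc l) x) / \<sigma>\<^sup>2) has_real_derivative
        ((1 * stein \<sigma> h (Suc l) x + stein \<sigma> h (Suc (Suc l)) x * x) + real (Suc l) * stein \<sigma> h (Suc l) x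
          - h (Suc (Suc l)) x) / \<sigma>\<^sup>2) (at x)"
      using less.prems 3 dh[of "Suc l"] less.IH[of l x] less.IH[of "Suc l" x]
      by (intro DERIV_cdivide DERIV_diff DERIV_add DERIV_cmult DERIV_mult DERIV_ident) auto
    moreover have "((1 * stein \<sigma> h (Suc l) x + stein \<sigma> h (Suc (Suc l)) x * x) + real (Suc l) * stein \<sigma> h (Suc l) x
          - h (Suc (Suc l)) x) / \<sigma>\<^sup>2 = stein \<sigma> h (Suc k) x"
      unfolding 3 stein.simps(3)[of \<sigma> h "Suc l"]
      by (simp add: algebra_simps)
    ultimately show ?thesis unfolding e by (simp only:)
  qed
qed

lemma stein_continuous: "k < N \<Longrightarrow> continuous_on UNIV (stein \<sigma> h k)"
  using stein_deriv by (meson DERIV_continuous continuous_at_imp_continuous_on)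

text \<open>Every derivative of the Stein solution solves an equation of the same form
  \<open>x u - \<sigma>\<^sup>2 u' = g\<close>; this is its \<open>g\<close>. Hence
  \<open>stein_growth\<close> can be applied at each order.\<close>

definition stein_rhs :: "nat \<Rightarrow> real \<Rightarrow> real" where
  "stein_rhs k x =
     (if k = 0 then h 0 x - Phi \<sigma> (h 0) else h k x - real k * stein \<sigma> h (k - 1) x)"

lemma stein_Suc: "stein \<sigma> h (Suc k) x = (x * stein \<sigma> h k x - stein_rhs k x) / \<sigma>\<^sup>2"
  by (cases k) (simp_all add: stein.simps(2,3) stein_rhs_def algebra_simps)

text \<open>The formula for order \<open>N\<close> involves \<open>h\<close> only up to order
  \<open>N - 1\<close>, where it is still continuous.\<close>

lemma stein_cont_N: "continuous_on UNIV (stein \<sigma> h N)"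
proof -
  obtain k where k: "N = Suc k" using N by (cases N) auto
  have "continuous_on UNIV (\<lambda>x. (x * stein \<sigma> h k x - stein_rhs k x) / \<sigma>\<^sup>2)"
  proof (intro continuous_intros)
    show "continuous_on UNIV (stein \<sigma> h k)" using k by (intro stein_continuous) auto
    show "continuous_on UNIV (stein_rhs k)"
    proof (cases "k = 0")
      case True
      then show ?thesis unfolding stein_rhs_def by (auto intro!: continuous_intros h0_continuous)
    next
      case False
      then show ?thesis unfolding stein_rhs_def
        using jet_class_continuous[OF h, of k] stein_continuous[of "k - 1"] k
        by (auto intro!: continuous_intros)
    qed
  qed (use \<sigma> in auto)
  then show ?thesis unfolding k by (simp only: stein_Suc[abs_def])
qed

lemma stein_prim:
  assumes "k \<le> N" shows "prim (stein \<sigma> h k) (stein \<sigma> h (Suc k))"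
proof (cases "k < N")
  case True
  have "continuous_on UNIV (stein \<sigma> h (Suc k))"
    using True stein_continuous[of "Suc k"] stein_cont_N by (cases "Suc k = N") auto
  then show ?thesis using True by (intro prim_deriv stein_deriv)
next
  case False
  then obtain k' where N': "N = Suc k'" and k: "k = N" using assms N by (cases N) auto
  (* h (N - 1) is only a primitive, but the remaining terms of the equation are continuously differentiable. *)
  define D where "D x = x * stein \<sigma> h k' x + real k' * stein \<sigma> h (k' - 1) x" for x
  define D' where "D' x = stein \<sigma> h k' x + x * stein \<sigma> h N x + real k' * stein \<sigma> h k' x" for x
  have "prim D D'"
  proof (rule prim_deriv)
    show "continuous_on UNIV D'" unfolding D'_def
      by (intro continuous_intros stein_cont_N stein_continuous) (use N' in auto)
    have 1: "(stein \<sigma> h k' has_real_derivative stein \<sigma> h N x) (at x)" for x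
      unfolding N' by (rule stein_deriv) (simp add: N')
    \<comment> \<open>For \<open>k' = 0\<close> the truncated index \<open>k' - 1\<close> does no
      harm, because its coefficient is 0.\<close>
    have 2: "((\<lambda>x. real k' * stein \<sigma> h (k' - 1) x) has_real_derivative real k' * stein \<sigma> h k' x) (at x)" for x
    proof (cases k')
      case (Suc l)
      show ?thesis unfolding Suc by (simp only: diff_Suc_1) (intro DERIV_cmult stein_deriv, simp add: N' Suc)
    qed simp
    show "(D has_real_derivative D' x) (at x)" for x
      unfolding D_def D'_def using DERIV_add[OF DERIV_mult[OF DERIV_ident 1[of x]] 2[of x]]
      by (simp add: mult.commute)
  qed
  then have "prim (\<lambda>x. (1 / \<sigma>\<^sup>2) * (D x + (-1) * h k' x)) (\<lambda>x. (1 / \<sigma>\<^sup>2) * (D' x + (-1) * h N x))"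
    using jet_class_prim[OF h, of k'] N' by (intro prim_cmult prim_add) auto
  moreover have "(1 / \<sigma>\<^sup>2) * (D' x + (-1) * h N x) = stein \<sigma> h (Suc N) x" for x
    unfolding D'_def stein_Suc[of N x] stein_rhs_def using N
    by (simp add: N' algebra_simps add_divide_distrib diff_divide_distrib)
  \<comment> \<open>For \<open>N = 1\<close> the equation contains the constant
    \<open>Phi \<sigma> (h 0)\<close>. It shifts the primitive by a constant and leaves increments
    unchanged.\<close>
  moreover have "(1 / \<sigma>\<^sup>2) * (D x + (-1) * h k' x) =
      stein \<sigma> h N x + (- (1 / \<sigma>\<^sup>2) * (if k' = 0 then Phi \<sigma> (h 0) else 0))" for x
    unfolding D_def N' stein_Suc[of k' x] stein_rhs_def by (auto simp: algebra_simps add_divide_distrib diff_divide_distrib)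
  ultimately have "prim (\<lambda>x. stein \<sigma> h N x + (- (1 / \<sigma>\<^sup>2) * (if k' = 0 then Phi \<sigma> (h 0) else 0)))
      (\<lambda>x. stein \<sigma> h (Suc N) x)" by (simp only:)
  then show ?thesis unfolding k prim_def by simp
qed

text \<open>Strong induction: \<open>stein_rhs k\<close> is built from \<open>h k\<close> and the
  solution at order \<open>k - 1\<close>, both of growth \<open>N + q - k\<close>, and
  \<open>stein_growth\<close> gains one power.\<close>

lemma stein_growth_all:
  assumes "k \<le> N" shows "growth (real N + q - real k - 1) (stein \<sigma> h k)"
  using assms
proof (induction k rule: less_induct)
  case (less k)
  have hk: "growth (real N + q - real k) (h k)"
    using jet_class_growth[OF h q less.prems] less.prems by (simp add: of_nat_diff algebra_simps)
  have rhs: "growth (real N + q - real k) (stein_rhs k)"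
  proof (cases k)
    case 0
    then show ?thesis using h0_centered_growth by (simp add: stein_rhs_def[abs_def])
  next
    case (Suc l)
    have "growth (real N + q - real l - 1) (stein \<sigma> h l)"
      using less Suc by (intro less.IH) auto
    then have "growth (real N + q - real k) (\<lambda>x. h k x - real k * stein \<sigma> h l x)"
      using hk Suc by (intro growth_diff growth_cmult) (auto simp: algebra_simps)
    then show ?thesis using Suc by (simp add: stein_rhs_def[abs_def])
  qed
  \<comment> \<open>Decay against the density is needed at both ends before the barrier applies. At
    order 0 it is the vanishing of the tail integrals; at higher orders the recursion gives a crude
    polynomial bound from the lower ones, which suffices.\<close>
  have lim: "((\<lambda>x. stein \<sigma> h k x * normal_density 0 \<sigma> x) \<longlongrightarrow> 0) at_top \<and>
      ((\<lambda>x. stein \<sigma> h k (- x) * normal_density 0 \<sigma> x) \<longlongrightarrow> 0) at_top"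
  proof (cases k)
    case 0
    have "((\<lambda>x. (LINT t:{x..}|lborel. (h 0 t - Phi \<sigma> (h 0)) * normal_density 0 \<sigma> t) / \<sigma>\<^sup>2) \<longlongrightarrow> 0 / \<sigma>\<^sup>2) at_top"
      using \<sigma> by (intro tendsto_divide tendsto_const set_integral_atLeast_at_top h0_centered_integrable) auto
    moreover have "((\<lambda>x. (LINT t:{-x..}|lborel. (h 0 t - Phi \<sigma> (h 0)) * normal_density 0 \<sigma> t) / \<sigma>\<^sup>2) \<longlongrightarrow> 0 / \<sigma>\<^sup>2) at_top"
      using \<sigma> set_integral_atLeast_at_bot[OF h0_centered_integrable] unfolding h0_centered_integral
      by (intro tendsto_divide tendsto_const) auto
    moreover have "stein \<sigma> h 0 (- x) * normal_density 0 \<sigma> x =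
       (LINT t:{-x..}|lborel. (h 0 t - Phi \<sigma> (h 0)) * normal_density 0 \<sigma> t) / \<sigma>\<^sup>2" for x
      using stein_0_gaussian[of "-x"] unfolding normal_density_even .
    ultimately show ?thesis unfolding 0 stein_0_gaussian by simp
  next
    case (Suc l)
    have l: "growth (real N + q - real l - 1) (stein \<sigma> h l)"
      using less Suc by (intro less.IH) auto
    then have l': "growth (real N + q - real l) (\<lambda>x. x * stein \<sigma> h l x)"
      using growth_mult_ident by fastforce
    have "growth (real N + q) (stein_rhs l)"
    proof (cases l)
      case 0
      then show ?thesis using h0_centered_growth by (simp add: stein_rhs_def[abs_def])
    next
      case (Suc j)
      have "growth (real N + q - real j - 1) (stein \<sigma> h j)"
        using less \<open>k = Suc l\<close> Suc by (intro less.IH) auto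
      moreover have "growth (real (N - l) + q) (h l)"
        using less \<open>k = Suc l\<close> by (intro jet_class_growth[OF h q]) auto
      ultimately have "growth (real N + q) (\<lambda>x. h l x - real l * stein \<sigma> h j x)"
        by (intro growth_diff growth_cmult) (auto elim!: growth_mono)
      then show ?thesis using Suc by (simp add: stein_rhs_def[abs_def])
    qed
    then have "growth (real N + q) (\<lambda>x. (x * stein \<sigma> h l x - stein_rhs l x) / \<sigma>\<^sup>2)"
      using l' by (intro growth_divide growth_diff) (auto elim!: growth_mono)
    then have "growth (real N + q) (stein \<sigma> h k)"
      unfolding Suc by (simp only: stein_Suc[abs_def])
    from growth_gaussian_at_top[OF this \<sigma>] growth_gaussian_at_top[OF growth_reflect[OF this] \<sigma>]
    show ?thesis by simp
  qed
  have "prim (stein \<sigma> h k) (\<lambda>x. (x * stein \<sigma> h k x - stein_rhs k x) / \<sigma>\<^sup>2)"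
    using stein_prim[OF less.prems] by (simp only: stein_Suc[abs_def])
  then show ?case
    using lim rhs less.prems q by (intro stein_growth[OF \<sigma>]) auto
qed

text \<open>Here the recursion is used algebraically: multiplication by \<open>x\<close> spends the
  power gained at order \<open>N\<close>, which leaves \<open>q\<close>.\<close>

lemma stein_growth_top: "growth q (stein \<sigma> h (Suc N))"
proof -
  obtain l where l: "N = Suc l" using N by (cases N) auto
  have 1: "growth q (\<lambda>x. x * stein \<sigma> h N x)"
    using growth_mult_ident[OF stein_growth_all[of N]] by simp
  have 2: "growth q (stein \<sigma> h l)"
    using stein_growth_all[of l] l by simp
  have "growth q (stein_rhs N)"
    using growth_diff[OF _ growth_cmult[OF 2, of "real N"], of "h N"] h l
    by (simp add: jet_class_def stein_rhs_def[abs_def])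
  then show ?thesis
    unfolding stein_Suc[abs_def] using 1 by (intro growth_divide growth_diff)
qed

text \<open>Up to order \<open>N\<close> the derivatives are continuous. Order \<open>N + 1\<close>
  may jump together with \<open>h N\<close>, so it is read off from its formula.\<close>

lemma stein_measurable: "k \<le> Suc N \<Longrightarrow> stein \<sigma> h k \<in> borel_measurable borel"
proof (cases "k \<le> N")
  case True
  then show ?thesis by (intro borel_measurable_continuous_onI prim_continuous[OF stein_prim])
next
  case False
  assume "k \<le> Suc N"
  with False have k: "k = Suc N" by simp
  obtain l where l: "N = Suc l" using N by (cases N) auto
  have [measurable]: "stein \<sigma> h N \<in> borel_measurable borel" "stein \<sigma> h l \<in> borel_measurable borel"
    using l by (auto intro!: borel_measurable_continuous_onI prim_continuous[OF stein_prim])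
  have [measurable]: "h N \<in> borel_measurable borel" using h by (simp add: jet_class_def)
  have "(\<lambda>x. (x * stein \<sigma> h N x - (h N x - real N * stein \<sigma> h l x)) / \<sigma>\<^sup>2) \<in> borel_measurable borel"
    by measurable
  then show ?thesis unfolding k stein_Suc[abs_def] stein_rhs_def by (simp add: l)
qed

lemma stein_growth_le:
  assumes "k \<le> Suc N" shows "growth (real N + q) (stein \<sigma> h k)"
proof (cases "k \<le> N")
  case True
  then show ?thesis using growth_mono[OF stein_growth_all[OF True]] by simp
next
  case False
  then show ?thesis using growth_mono[OF stein_growth_top, of "real N + q"] assms
    by (simp add: le_Suc_eq)
qed

lemma stein_has_derivs: "has_derivs (Suc N) (stein \<sigma> h)"
  unfolding has_derivs_def
proof (intro conjI allI impI)
  show "(stein \<sigma> h k has_real_derivative stein \<sigma> h (Suc k) x) (at x)" if "Suc k < Suc N" for k x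
    by (rule stein_deriv) (use that in simp)
  fix a b :: real assume "a \<le> b"
  then show "set_integrable lborel {a..b} (stein \<sigma> h (Suc N))"
      "stein \<sigma> h (Suc N - 1) b - stein \<sigma> h (Suc N - 1) a = (LINT t:{a..b}|lborel. stein \<sigma> h (Suc N) t)"
    using stein_prim[OF order_refl] unfolding prim_def by simp_all
qed

lemma stein_well_defined: "stein_wd (Suc N) \<sigma> h"
  unfolding stein_wd_def
proof (intro conjI allI)
  show "Phi_wd \<sigma> (h 0)"
    using jet_class_growth[OF h q, of 0] borel_measurable_continuous_onI[OF h0_continuous] \<sigma>
    by (intro Phi_wd_growth) auto
  show "set_integrable lborel {x..} (\<lambda>t. (h 0 t - Phi \<sigma> (h 0)) * normal_density 0 \<sigma> t)" for x
    unfolding set_integrable_def by (rule integrable_mult_indicator[OF _ h0_centered_integrable]) simp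
qed (rule stein_has_derivs)

text \<open>This closes the recursion: the top order of the new jet is
  \<open>N - k + (k + 1) = Suc N\<close>, where the growth exponent is again
  \<open>q\<close>.\<close>

lemma jet_class_stein:
  assumes "1 \<le> k" "k \<le> N"
  shows "jet_class (N - k) q (jet_deriv (k + 1) (stein \<sigma> h))"
  unfolding jet_class_def
proof (intro conjI)
  have e: "N - k + (k + 1) = Suc N" using assms by simp
  show "jet_deriv (k + 1) (stein \<sigma> h) (N - k) \<in> borel_measurable borel"
    unfolding jet_deriv_def e by (rule stein_measurable) simp
  show "growth q (jet_deriv (k + 1) (stein \<sigma> h) (N - k))"
    unfolding jet_deriv_def e by (rule stein_growth_top)
  show "has_derivs (N - k) (jet_deriv (k + 1) (stein \<sigma> h))"
    unfolding has_derivs_def jet_deriv_def e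
  proof (intro conjI allI impI)
    fix j x assume "Suc j < N - k"
    then show "(stein \<sigma> h (j + (k + 1)) has_real_derivative stein \<sigma> h (Suc j + (k + 1)) x) (at x)"
      using stein_deriv[of "j + (k + 1)" x] by simp
  next
    fix a b :: real assume *: "0 < N - k" "a \<le> b"
    then have e': "N - k - 1 + (k + 1) = N" by simp
    show "set_integrable lborel {a..b} (stein \<sigma> h (Suc N))"
      using stein_prim[of N] * by (simp add: prim_def)
    show "stein \<sigma> h (N - k - 1 + (k + 1)) b - stein \<sigma> h (N - k - 1 + (k + 1)) a =
        (LINT t:{a..b}|lborel. stein \<sigma> h (Suc N) t)"
      unfolding e' using stein_prim[of N] * by (simp add: prim_def)
  qed
qed

end

section \<open>Growth of functions in the space \<open>HN\<close>\<close>

lemma abs_pow_le: "0 \<le> p \<Longrightarrow> abs_pow p x \<le> (1 + \<bar>x\<bar>) powr p"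
  by (auto simp: abs_pow_def intro!: powr_mono2)

text \<open>The Hoelder quotient is taken with \<open>y = 0\<close>. The factor 3 counts the
  summands of its second factor, each at most \<open>(1 + \<bar>x\<bar>) powr p\<close>.\<close>

lemma hoelder_norm_growth:
  assumes fin: "hoelder_norm \<alpha> p g < \<infinity>" and g0: "g 0 = 0" and \<alpha>: "0 < \<alpha>" and p: "0 \<le> p"
  shows "growth (\<alpha> + p) g"
proof -
  define C where "C = enn2real (hoelder_norm \<alpha> p g)"
  have C: "0 \<le> C" "hoelder_norm \<alpha> p g = ennreal C" using fin by (auto simp: C_def less_top)
  have "\<bar>g x\<bar> \<le> (C * 3) * (1 + \<bar>x\<bar>) powr (\<alpha> + p)" for x
  proof (cases "x = 0")
    case True
    then show ?thesis using g0 C by simp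
  next
    case False
    define w where "w = \<bar>x\<bar> powr \<alpha> * (1 + abs_pow p x + abs_pow p 0)"
    have nn: "0 \<le> abs_pow p y" for y by (simp add: abs_pow_def)
    have w: "0 < w" unfolding w_def using False nn[of x] nn[of 0] by simp
    have "ennreal (\<bar>g x - g 0\<bar> / (\<bar>x - 0\<bar> powr \<alpha> * (1 + abs_pow p x + abs_pow p 0))) \<le> hoelder_norm \<alpha> p g"
      unfolding hoelder_norm_def using False by (intro SUP_upper2[of "(x, 0)"]) auto
    then have "\<bar>g x\<bar> / w \<le> C" using C g0 by (simp add: w_def)
    then have "\<bar>g x\<bar> \<le> C * w" using w by (simp add: field_simps)
    also have "w \<le> (1 + \<bar>x\<bar>) powr \<alpha> * (3 * (1 + \<bar>x\<bar>) powr p)"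
      unfolding w_def
    proof (rule mult_mono)
      have "1 \<le> (1 + \<bar>x\<bar>) powr p" using p by (intro ge_one_powr_ge_zero) auto
      then show "1 + abs_pow p x + abs_pow p 0 \<le> 3 * (1 + \<bar>x\<bar>) powr p"
        using abs_pow_le[OF p, of x] abs_pow_le[OF p, of 0] by simp
    qed (use \<alpha> nn[of x] nn[of 0] in \<open>auto intro!: powr_mono2\<close>)
    finally show ?thesis using C by (simp add: powr_add mult_left_mono mult.assoc mult.left_commute)
  qed
  then show ?thesis by (rule growthI)
qed

text \<open>Between two points of continuity the increment is a finite sum of jumps, bounded by the
  total \<open>K\<close> of all absolute jumps. The values on \<open>D\<close> are arbitrary but
  finite in number, so they enter the bound separately.\<close>

lemma pure_jump_bounded:
  assumes pj: "pure_jump d" and D: "finite D" and c: "\<And>x. x \<notin> D \<Longrightarrow> isCont d x"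
  shows "\<exists>K. \<forall>x. \<bar>d x\<bar> \<le> K"
proof -
  define J where "J y = Lim (at_right y) d - Lim (at_left y) d" for y
  have R: "Lim (at_right y) d = d y" and L: "Lim (at_left y) d = d y" if "y \<notin> D" for y
    using c[OF that] unfolding isCont_def
    by (auto intro!: tendsto_Lim elim: filterlim_mono simp: at_le)
  define K where "K = (\<Sum>y\<in>D. \<bar>J y\<bar>)"
  have inc: "\<bar>d b - d a\<bar> \<le> K" if "a \<notin> D" "b \<notin> D" "a < b" for a b
  proof -
    have "(J has_sum (Lim (at_left b) d - Lim (at_right a) d)) {a<..<b}"
      using pj that(3) unfolding pure_jump_def J_def[abs_def] by blast
    then have "(J has_sum (d b - d a)) {a<..<b}"
      using R[OF that(1)] L[OF that(2)] by simp
    moreover have "(J has_sum (\<Sum>y\<in>D \<inter> {a<..<b}. J y)) {a<..<b}"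
      using D R L by (intro has_sum_finite_neutralI[of "D \<inter> {a<..<b}"]) (auto simp: J_def)
    ultimately have "d b - d a = (\<Sum>y\<in>D \<inter> {a<..<b}. J y)" by (rule has_sum_unique)
    also have "\<bar>\<dots>\<bar> \<le> (\<Sum>y\<in>D \<inter> {a<..<b}. \<bar>J y\<bar>)" by (rule sum_abs)
    also have "\<dots> \<le> K" unfolding K_def using D by (intro sum_mono2) auto
    finally show ?thesis .
  qed
  obtain a where a: "a \<notin> D" using ex_new_if_finite[OF _ D] infinite_UNIV_char_0 by blast
  have K: "0 \<le> K" by (simp add: K_def sum_nonneg)
  have "\<bar>d x\<bar> \<le> \<bar>d a\<bar> + K + (\<Sum>y\<in>D. \<bar>d y\<bar>)" for x
  proof (cases "x \<in> D")
    case True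
    then show ?thesis using member_le_sum[OF True, of "\<lambda>y. \<bar>d y\<bar>"] D K by simp
  next
    case False
    have "\<bar>d x - d a\<bar> \<le> K"
      using inc[OF a False] inc[OF False a] K by (cases x a rule: linorder_cases) (auto simp: abs_minus_commute)
    moreover have "0 \<le> (\<Sum>y\<in>D. \<bar>d y\<bar>)" by (simp add: sum_nonneg)
    ultimately show ?thesis by linarith
  qed
  then show ?thesis by blast
qed

text \<open>The continuous part grows by its Hoelder bound and the jump part is bounded.
  Measurability holds because \<open>h N\<close> is continuous off a finite set.\<close>

lemma HN_jet_class:
  assumes h: "h \<in> HN N \<alpha> p" and \<alpha>: "0 < \<alpha>" and p: "0 \<le> p"
  shows "jet_class N (\<alpha> + p) h"
proof -
  define D where "D = {x. \<not> isCont (h N) x}"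
  have D: "finite D" using h by (auto simp: HN_def D_def)
  obtain gc where gc: "is_continuous_part (h N) gc" "hoelder_norm \<alpha> p gc < \<infinity>"
    using h by (auto simp: HN_def)
  have gcc: "isCont gc x" for x
    using gc(1) by (auto simp: is_continuous_part_def continuous_on_eq_continuous_at)
  have "\<exists>K. \<forall>x. \<bar>h N x - gc x\<bar> \<le> K"
    by (rule pure_jump_bounded[OF _ D])
      (use gc(1) gcc in \<open>auto simp: is_continuous_part_def D_def intro!: continuous_intros\<close>)
  then obtain K where K: "\<And>x. \<bar>h N x - gc x\<bar> \<le> K" by blast
  have "growth (\<alpha> + p) (\<lambda>x. h N x - gc x)"
    by (rule growth_mono[of 0]) (use \<alpha> p K in \<open>auto intro!: growthI[where C=K]\<close>)
  moreover have "growth (\<alpha> + p) gc"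
    using gc \<alpha> p by (intro hoelder_norm_growth) (auto simp: is_continuous_part_def)
  ultimately have "growth (\<alpha> + p) (h N)"
    using growth_add by fastforce
  moreover have "continuous_on (- D) (h N)"
    by (auto simp: D_def intro!: continuous_at_imp_continuous_on)
  then have "h N \<in> borel_measurable borel"
    using borel_measurable_continuous_countable_exceptions[of D] D countable_finite by blast
  ultimately show ?thesis using h by (auto simp: jet_class_def HN_def)
qed

section \<open>Multi-indices\<close>

lemma mindex_0: "mindex 0 m = {[]}"
  by (auto simp: mindex_def)

lemma mindex_length_le_sum: "\<forall>j\<in>set J. 1 \<le> j \<Longrightarrow> length J \<le> sum_list J" for J :: "nat list"
  by (induction J) auto

lemma mindex_empty: "m < d \<Longrightarrow> mindex d m = {}"
  using mindex_length_le_sum by (fastforce simp: mindex_def)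

lemma mindex_sum_le: "J \<in> mindex d m \<Longrightarrow> sum_list J \<le> m"
  by (simp add: mindex_def)

lemma finite_mindex: "finite (mindex d m)"
proof (rule finite_subset)
  show "mindex d m \<subseteq> {J. set J \<subseteq> {..m} \<and> length J = d}"
    by (auto simp: mindex_def dest: member_le_sum_list)
  show "finite {J. set J \<subseteq> {..m} \<and> length J = d}"
    by (rule finite_lists_length_eq) simp
qed

text \<open>The bijection \<open>J = K @ [k]\<close>, with the prefix summed outermost. This is the
  shape in which the moment sums inside \<open>delta\<close> lengthen a given multi-index.\<close>

lemma sum_mindex_Suc:
  fixes F :: "nat list \<Rightarrow> nat \<Rightarrow> real"
  shows "(\<Sum>J\<in>mindex (Suc d) m. F (butlast J) (last J)) =
    (\<Sum>J\<in>mindex d m. \<Sum>k=1..m - sum_list J. F J k)"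
proof -
  have "(\<Sum>J\<in>mindex d m. \<Sum>k=1..m - sum_list J. F J k) =
      (\<Sum>(J, k)\<in>(SIGMA J:mindex d m. {1..m - sum_list J}). F J k)"
    by (rule sum.Sigma) (auto simp: finite_mindex)
  also have "\<dots> = (\<Sum>J\<in>mindex (Suc d) m. F (butlast J) (last J))"
  proof (rule sum.reindex_bij_witness[where i="\<lambda>J. (butlast J, last J)" and j="\<lambda>(J, k). J @ [k]"])
    fix J assume J: "J \<in> mindex (Suc d) m"
    then have ne: "J \<noteq> []" by (auto simp: mindex_def)
    then obtain K k where K: "J = K @ [k]" by (metis append_butlast_last_id)
    show "(case (butlast J, last J) of (J, k) \<Rightarrow> J @ [k]) = J" using ne by simp
    show "(butlast J, last J) \<in> (SIGMA J:mindex d m. {1..m - sum_list J})"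
      using J unfolding K by (auto simp: mindex_def)
  qed (auto simp: mindex_def)
  finally show ?thesis by simp
qed

text \<open>The same bijection with the last entry outermost: once \<open>k\<close> is fixed, the
  prefixes are the multi-indices of total at most \<open>m - k\<close>, as in an inverse expansion
  of order \<open>m - k\<close>.\<close>

lemma sum_mindex_Suc_shift:
  fixes F :: "nat list \<Rightarrow> nat \<Rightarrow> real"
  shows "(\<Sum>J\<in>mindex (Suc d) m. F (butlast J) (last J)) =
    (\<Sum>k=1..m. \<Sum>J\<in>mindex d (m - k). F J k)"
proof -
  have "(\<Sum>J\<in>mindex d m. \<Sum>k=1..m - sum_list J. F J k) =
      (\<Sum>(J, k)\<in>(SIGMA J:mindex d m. {1..m - sum_list J}). F J k)"
    by (rule sum.Sigma) (auto simp: finite_mindex)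
  also have "\<dots> = (\<Sum>(k, J)\<in>(SIGMA k:{1..m}. mindex d (m - k)). F J k)"
    by (rule sum.reindex_bij_witness[where i="\<lambda>(k, J). (J, k)" and j="\<lambda>(J, k). (k, J)"])
      (auto simp: mindex_def)
  also have "\<dots> = (\<Sum>k=1..m. \<Sum>J\<in>mindex d (m - k). F J k)"
    by (rule sum.Sigma[symmetric]) (auto simp: finite_mindex)
  finally show ?thesis unfolding sum_mindex_Suc .
qed

lemma mindex_snoc:
  assumes "J \<in> mindex (Suc d) m"
  obtains K k where "J = K @ [k]"
  using assms by (cases J rule: rev_cases) (auto simp: mindex_def)

lemma sum_list_butlast_last: "J \<in> mindex (Suc d) m \<Longrightarrow> sum_list J = sum_list (butlast J) + last J"
  by (elim mindex_snoc) simp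

lemma momJ_butlast_last:
  "J \<in> mindex (Suc d) m \<Longrightarrow> momJ P Y J = momJ P Y (butlast J) * mom P Y (last J)"
  by (elim mindex_snoc) (simp add: momJ_def)

lemma sum_alternating_telescope:
  fixes T :: "nat \<Rightarrow> real"
  shows "(\<Sum>d=0..m. (-1) ^ d * (T d + T (Suc d))) = T 0 + (-1) ^ m * T (Suc m)"
  by (induction m) (auto simp: algebra_simps)

lemma (in prob_space) mom_0: "mom M Y 0 = 1"
  by (simp add: mom_def prob_space)

text \<open>In the sum defining \<open>eps\<close>, the term of \<open>J\<close> contributes \<open>J\<close> and its extensions \<open>J @ [k]\<close>,
  with opposite signs for successive lengths, so the sum telescopes.\<close>

lemma (in prob_space) expectation_inverse_expansion:
  "(\<integral>\<omega>. f 0 (X \<omega>) \<partial>M) =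
     (\<Sum>d=0..m. (-1) ^ d * (\<Sum>J\<in>mindex d m. momJ M Y J * (\<integral>\<omega>. f (sum_list J) (X \<omega> + Y \<omega>) \<partial>M)))
     + eps M m f X Y"
proof -
  define a where "a j = (\<integral>\<omega>. f j (X \<omega>) \<partial>M)" for j
  define b where "b j = (\<integral>\<omega>. f j (X \<omega> + Y \<omega>) \<partial>M)" for j
  define T where "T d = (\<Sum>J\<in>mindex d m. momJ M Y J * a (sum_list J))" for d
  have T_Suc: "T (Suc d) = (\<Sum>J\<in>mindex d m. \<Sum>k=1..m - sum_list J. momJ M Y J * (mom M Y k * a (k + sum_list J)))" for d
  proof -
    have "T (Suc d) = (\<Sum>J\<in>mindex (Suc d) m. momJ M Y (butlast J) * (mom M Y (last J) * a (last J + sum_list (butlast J))))"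
      unfolding T_def
      by (intro sum.cong) (auto simp: momJ_butlast_last sum_list_butlast_last add.commute)
    also have "\<dots> = (\<Sum>J\<in>mindex d m. \<Sum>k=1..m - sum_list J. momJ M Y J * (mom M Y k * a (k + sum_list J)))"
      by (rule sum_mindex_Suc)
    finally show ?thesis .
  qed
  have "(\<Sum>J\<in>mindex d m. momJ M Y J * delta M (m - sum_list J) (jet_deriv (sum_list J) f) X Y) =
      (\<Sum>J\<in>mindex d m. momJ M Y J * b (sum_list J)) - (T d + T (Suc d))" for d
  proof -
    have "momJ M Y J * delta M (m - sum_list J) (jet_deriv (sum_list J) f) X Y =
        momJ M Y J * b (sum_list J) - (momJ M Y J * a (sum_list J) +
          (\<Sum>k=1..m - sum_list J. momJ M Y J * (mom M Y k * a (k + sum_list J))))" for J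
    proof -
      \<comment> \<open>The term \<open>k = 0\<close> has moment 1 and reproduces
        \<open>T d\<close>; the terms with \<open>1 \<le> k\<close> lengthen \<open>J\<close> and
        make up \<open>T (Suc d)\<close>.\<close>
      have "(\<Sum>k\<le>m - sum_list J. mom M Y k * a (k + sum_list J)) =
          a (sum_list J) + (\<Sum>k=1..m - sum_list J. mom M Y k * a (k + sum_list J))"
        by (simp add: atMost_atLeast0 sum.atLeast_Suc_atMost mom_0)
      then show ?thesis
        by (simp add: delta_def jet_deriv_def a_def[symmetric] b_def[symmetric] right_diff_distrib
            distrib_left sum_distrib_left)
    qed
    then show ?thesis by (simp add: sum_subtractf sum.distrib T_def[of d] T_Suc)
  qed
  then have "eps M m f X Y = - (\<Sum>d=0..m. (-1) ^ d * ((\<Sum>J\<in>mindex d m. momJ M Y J * b (sum_list J)) - (T d + T (Suc d))))"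
    by (simp add: eps_def)
  also have "\<dots> = (\<Sum>d=0..m. (-1) ^ d * (T d + T (Suc d))) -
      (\<Sum>d=0..m. (-1) ^ d * (\<Sum>J\<in>mindex d m. momJ M Y J * b (sum_list J)))"
    by (simp add: right_diff_distrib sum_subtractf)
  \<comment> \<open>\<open>T 0\<close> belongs to the empty multi-index, and
    \<open>T (Suc m)\<close> is an empty sum because entries are at least 1.\<close>
  also have "(\<Sum>d=0..m. (-1) ^ d * (T d + T (Suc d))) = a 0"
    unfolding sum_alternating_telescope by (simp add: T_def mindex_0 mindex_empty momJ_def)
  finally show ?thesis by (simp add: a_def b_def)
qed

text \<open>The expectation with \<open>Z\<close> is expanded around \<open>X\<close> with remainder
  \<open>delta\<close>, and each term of order \<open>k\<close> is re-expanded around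
  \<open>X + Y\<close> to depth \<open>N - k\<close>. For \<open>1 \<le> k\<close> the moment of
  \<open>Z\<close> becomes the last coordinate; the terms of \<open>k = 0\<close> carry a moment of
  \<open>Y\<close> in that place, with opposite sign. Together they give the moment
  differences.\<close>

lemma (in prob_space) zero_bias_expansion:
  "(\<integral>\<omega>. f 0 (X \<omega> + Z \<omega>) \<partial>M) - (\<integral>\<omega>. f 0 (X \<omega> + Y \<omega>) \<partial>M) =
     (\<Sum>d=1..N. (-1) ^ (d - 1) * (\<Sum>J\<in>mindex d N.
        momJ M Y (butlast J) * (mom M Z (last J) - mom M Y (last J)) *
        (\<integral>\<omega>. f (sum_list J) (X \<omega> + Y \<omega>) \<partial>M)))
     + (\<Sum>k=0..N. eps M (N - k) (jet_deriv k f) X Y * mom M Z k)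
     + delta M N f X Z"
proof -
  define b where "b j = (\<integral>\<omega>. f j (X \<omega> + Y \<omega>) \<partial>M)" for j
  define V where "V d k = (\<Sum>J\<in>mindex d (N - k). momJ M Y J * b (sum_list J + k))" for d k
  have V: "(\<integral>\<omega>. f k (X \<omega>) \<partial>M) = (\<Sum>d=0..N. (-1) ^ d * V d k) + eps M (N - k) (jet_deriv k f) X Y" if "k \<le> N" for k
  proof -
    have "(\<integral>\<omega>. f k (X \<omega>) \<partial>M) = (\<Sum>d=0..N - k. (-1) ^ d * V d k) + eps M (N - k) (jet_deriv k f) X Y"
      using expectation_inverse_expansion[where f="jet_deriv k f" and X=X and Y=Y and m="N - k"]
      by (simp add: jet_deriv_def V_def b_def)
    \<comment> \<open>The added lengths \<open>d\<close> exceed \<open>N - k\<close> and contribute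
      empty sums. A common upper limit allows the sums over \<open>d\<close> and \<open>k\<close> to
      be exchanged.\<close>
    also have "(\<Sum>d=0..N - k. (-1) ^ d * V d k) = (\<Sum>d=0..N. (-1) ^ d * V d k)"
      by (rule sum.mono_neutral_left) (auto simp: V_def mindex_empty)
    finally show ?thesis .
  qed
  define Q where "Q d = (\<Sum>J\<in>mindex d N. momJ M Y (butlast J) * mom M Z (last J) * b (sum_list J))" for d
  define R where "R d = (\<Sum>J\<in>mindex d N. momJ M Y (butlast J) * mom M Y (last J) * b (sum_list J))" for d
  have Q: "(\<Sum>k=1..N. mom M Z k * V d k) = Q (Suc d)" for d
  proof -
    have "Q (Suc d) = (\<Sum>J\<in>mindex (Suc d) N. mom M Z (last J) * (momJ M Y (butlast J) * b (sum_list (butlast J) + last J)))"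
      unfolding Q_def by (intro sum.cong) (auto simp: sum_list_butlast_last)
    also have "\<dots> = (\<Sum>k=1..N. \<Sum>J\<in>mindex d (N - k). mom M Z k * (momJ M Y J * b (sum_list J + k)))"
      by (rule sum_mindex_Suc_shift)
    finally show ?thesis by (simp add: V_def sum_distrib_left)
  qed
  have R: "V (Suc d) 0 = R (Suc d)" for d
    unfolding V_def R_def by (intro sum.cong) (auto simp: momJ_butlast_last)
  have alt: "(\<Sum>d=1..N. (-1) ^ (d - 1) * U d) = (\<Sum>d<N. (-1) ^ d * U (Suc d))" for U :: "nat \<Rightarrow> real"
    by (rule sum.reindex_bij_witness[where i=Suc and j="\<lambda>d. d - 1"]) auto
  have Q_top: "Q (Suc N) = 0" by (simp add: Q_def mindex_empty)
  have "(\<Sum>k\<le>N. mom M Z k * (\<integral>\<omega>. f k (X \<omega>) \<partial>M)) =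
      (\<Sum>k=0..N. mom M Z k * (\<Sum>d=0..N. (-1) ^ d * V d k)) + (\<Sum>k=0..N. eps M (N - k) (jet_deriv k f) X Y * mom M Z k)"
    unfolding atMost_atLeast0 sum.distrib[symmetric] by (intro sum.cong) (auto simp: V algebra_simps)
  also have "(\<Sum>k=0..N. mom M Z k * (\<Sum>d=0..N. (-1) ^ d * V d k)) =
      (\<Sum>d=0..N. (-1) ^ d * V d 0) + (\<Sum>k=1..N. mom M Z k * (\<Sum>d=0..N. (-1) ^ d * V d k))"
    by (simp add: sum.atLeast_Suc_atMost mom_0)
  also have "(\<Sum>k=1..N. mom M Z k * (\<Sum>d=0..N. (-1) ^ d * V d k)) =
      (\<Sum>d=0..N. \<Sum>k=1..N. mom M Z k * ((-1) ^ d * V d k))"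
    unfolding sum_distrib_left by (rule sum.swap)
  also have "\<dots> = (\<Sum>d=0..N. (-1) ^ d * Q (Suc d))"
    unfolding Q[symmetric] sum_distrib_left by (simp add: mult.left_commute)
  also have "\<dots> = (\<Sum>d<N. (-1) ^ d * Q (Suc d))"
    unfolding atLeast0AtMost lessThan_Suc_atMost[symmetric] by (simp add: Q_top)
  \<comment> \<open>Length 0 contributes \<open>b 0\<close>; the index shift in the other terms
    causes the change of sign.\<close>
  also have "(\<Sum>d=0..N. (-1) ^ d * V d 0) = b 0 - (\<Sum>d<N. (-1) ^ d * R (Suc d))"
  proof -
    have "(\<Sum>d=0..N. (-1) ^ d * V d 0) = V 0 0 + (\<Sum>d<N. (-1) ^ Suc d * V (Suc d) 0)"
      unfolding atLeast0AtMost lessThan_Suc_atMost[symmetric] by (subst sum.lessThan_Suc_shift) simp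
    then show ?thesis by (simp add: R sum_negf V_def[of 0 0] mindex_0 momJ_def)
  qed
  finally have main: "(\<Sum>k\<le>N. mom M Z k * (\<integral>\<omega>. f k (X \<omega>) \<partial>M)) =
      b 0 + (\<Sum>d<N. (-1) ^ d * (Q (Suc d) - R (Suc d))) + (\<Sum>k=0..N. eps M (N - k) (jet_deriv k f) X Y * mom M Z k)"
    by (simp add: right_diff_distrib sum_subtractf)
  have "Q d - R d = (\<Sum>J\<in>mindex d N. momJ M Y (butlast J) * (mom M Z (last J) - mom M Y (last J)) * b (sum_list J))" for d
    by (simp add: Q_def R_def sum_subtractf[symmetric] algebra_simps)
  then have "(\<Sum>d<N. (-1) ^ d * (Q (Suc d) - R (Suc d))) = (\<Sum>d=1..N. (-1) ^ (d - 1) * (\<Sum>J\<in>mindex d N.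
        momJ M Y (butlast J) * (mom M Z (last J) - mom M Y (last J)) * b (sum_list J)))"
    unfolding alt[of "\<lambda>d. Q d - R d", symmetric] by simp
  then show ?thesis using main by (simp add: delta_def b_def)
qed

section \<open>Moments and zero bias\<close>

text \<open>The weight is that of \<open>growth\<close>, so a function of growth \<open>r\<close> is
  dominated directly, and lower moments follow from higher ones.\<close>

definition abs_moment :: "'a measure \<Rightarrow> real \<Rightarrow> ('a \<Rightarrow> real) \<Rightarrow> bool" where
  "abs_moment P r Y \<longleftrightarrow> Y \<in> borel_measurable P \<and> integrable P (\<lambda>\<omega>. (1 + \<bar>Y \<omega>\<bar>) powr r)"

lemma abs_moment_measurable: "abs_moment P r Y \<Longrightarrow> Y \<in> borel_measurable P"
  by (simp add: abs_moment_def)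

lemma abs_moment_integrable:
  assumes Y: "abs_moment P r Y" and u: "growth s u" "u \<in> borel_measurable borel" and s: "s \<le> r"
  shows "integrable P (\<lambda>\<omega>. u (Y \<omega>))"
proof -
  obtain C where C: "0 \<le> C" "\<And>x. \<bar>u x\<bar> \<le> C * (1 + \<bar>x\<bar>) powr r"
    by (rule growthE[OF growth_mono[OF u(1) s]]) blast
  have "integrable P (\<lambda>\<omega>. C * (1 + \<bar>Y \<omega>\<bar>) powr r)"
    using Y by (simp add: abs_moment_def)
  then show ?thesis
  proof (rule Bochner_Integration.integrable_bound)
    show "(\<lambda>\<omega>. u (Y \<omega>)) \<in> borel_measurable P"
      using measurable_compose[OF abs_moment_measurable[OF Y] u(2)] by simp
    show "AE \<omega> in P. norm (u (Y \<omega>)) \<le> norm (C * (1 + \<bar>Y \<omega>\<bar>) powr r)"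
      using C by (auto intro!: AE_I2)
  qed
qed

lemma abs_moment_mono:
  assumes "abs_moment P r Y" "s \<le> r"
  shows "abs_moment P s Y"
proof -
  have "growth s (\<lambda>x. (1 + \<bar>x\<bar>) powr s)" by (rule growthI[where C=1]) simp
  then have "integrable P (\<lambda>\<omega>. (1 + \<bar>Y \<omega>\<bar>) powr s)"
    using abs_moment_integrable[OF assms(1), of s "\<lambda>x. (1 + \<bar>x\<bar>) powr s"] assms(2) by simp
  then show ?thesis using assms(1) by (simp add: abs_moment_def)
qed

lemma abs_moment_mom_wd:
  assumes "abs_moment P r Y" "real k \<le> r"
  shows "mom_wd P Y k"
proof -
  have "growth (real k) (\<lambda>x. x ^ k)"
    by (rule growthI[where C=1]) (auto simp: power_abs powr_realpow intro!: power_mono)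
  then show ?thesis
    unfolding mom_wd_def using abs_moment_integrable[OF assms(1), of "real k" "\<lambda>x. x ^ k"] assms(2) by simp
qed

lemma abs_moment_of_powr:
  assumes "Y \<in> borel_measurable P" "integrable P (\<lambda>\<omega>. \<bar>Y \<omega>\<bar> powr r)" "0 \<le> r" "finite_measure P"
  shows "abs_moment P r Y"
proof -
  interpret finite_measure P by fact
  have "integrable P (\<lambda>\<omega>. 2 powr r * (1 + \<bar>Y \<omega>\<bar> powr r))"
    using assms(2) by simp
  then have "integrable P (\<lambda>\<omega>. (1 + \<bar>Y \<omega>\<bar>) powr r)"
  proof (rule Bochner_Integration.integrable_bound)
    show "(\<lambda>\<omega>. (1 + \<bar>Y \<omega>\<bar>) powr r) \<in> borel_measurable P" using assms(1) by simp
    show "AE \<omega> in P. norm ((1 + \<bar>Y \<omega>\<bar>) powr r) \<le> norm (2 powr r * (1 + \<bar>Y \<omega>\<bar> powr r))"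
      using powr_sum_le[of 1 "\<bar>Y _\<bar>" r] assms(3) by (intro AE_I2) simp
  qed
  then show ?thesis using assms(1) by (simp add: abs_moment_def)
qed

lemma abs_moment_add:
  assumes "abs_moment P r Y" "abs_moment P r Z" "0 \<le> r"
  shows "abs_moment P r (\<lambda>\<omega>. Y \<omega> + Z \<omega>)"
proof -
  have m [measurable]: "Y \<in> borel_measurable P" "Z \<in> borel_measurable P"
    using assms by (auto simp: abs_moment_def)
  have "integrable P (\<lambda>\<omega>. 2 powr r * ((1 + \<bar>Y \<omega>\<bar>) powr r + (1 + \<bar>Z \<omega>\<bar>) powr r))"
    using assms by (simp add: abs_moment_def)
  then have "integrable P (\<lambda>\<omega>. (1 + \<bar>Y \<omega> + Z \<omega>\<bar>) powr r)"
  proof (rule Bochner_Integration.integrable_bound)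
    have "(1 + \<bar>y + z\<bar>) powr r \<le> 2 powr r * ((1 + \<bar>y\<bar>) powr r + (1 + \<bar>z\<bar>) powr r)" for y z :: real
    proof -
      have "(1 + \<bar>y + z\<bar>) powr r \<le> ((1 + \<bar>y\<bar>) + (1 + \<bar>z\<bar>)) powr r"
        using assms(3) by (intro powr_mono2) auto
      also have "\<dots> \<le> 2 powr r * ((1 + \<bar>y\<bar>) powr r + (1 + \<bar>z\<bar>) powr r)"
        using assms(3) by (intro powr_sum_le) auto
      finally show ?thesis .
    qed
    then show "AE \<omega> in P. norm ((1 + \<bar>Y \<omega> + Z \<omega>\<bar>) powr r)
        \<le> norm (2 powr r * ((1 + \<bar>Y \<omega>\<bar>) powr r + (1 + \<bar>Z \<omega>\<bar>) powr r))"
      by (intro AE_I2) simp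
  qed simp
  then show ?thesis by (simp add: abs_moment_def)
qed

lemma (in prob_space) abs_moment_sum:
  assumes "finite I" "\<And>i. i \<in> I \<Longrightarrow> abs_moment M r (Y i)" "0 \<le> r"
  shows "abs_moment M r (\<lambda>\<omega>. \<Sum>i\<in>I. Y i \<omega>)"
  using assms(1,2)
proof (induction I rule: finite_induct)
  case empty
  then show ?case by (simp add: abs_moment_def)
next
  case (insert i I)
  then show ?case using abs_moment_add[OF _ _ assms(3), of M "Y i" "\<lambda>\<omega>. \<Sum>i\<in>I. Y i \<omega>"] by simp
qed

text \<open>The definition of the zero biased distribution only speaks about functions with \<open>f' (Xs)\<close>
  integrable, so the moment is obtained from truncated powers.\<close>

lemma (in prob_space) zero_biased_abs_moment:
  assumes X: "abs_moment M r X" and r: "2 \<le> r" and zb: "zero_biased M X Xs" and var: "0 < Var M X"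
  shows "abs_moment M (r - 2) Xs"
proof -
  have Xs [measurable]: "Xs \<in> borel_measurable M" using zb by (simp add: zero_biased_def)
  have X_m [measurable]: "X \<in> borel_measurable M" using X by (simp add: abs_moment_def)
  define g where "g m x = min ((1 + \<bar>x\<bar>) powr (r - 2)) (real m)" for m :: nat and x :: real
  have g_int: "integrable M (\<lambda>\<omega>. g m (Xs \<omega>))" for m
    by (rule integrable_const_bound[where B="real m"]) (auto simp: g_def)
  have bnd: "(\<integral>\<omega>. g m (Xs \<omega>) \<partial>M) \<le> (\<integral>\<omega>. (1 + \<bar>X \<omega>\<bar>) powr r \<partial>M) / Var M X" for m
  proof -
    have cont: "continuous_on UNIV (g m)" unfolding g_def by (intro continuous_intros) auto
    obtain G where G: "\<And>x. (G has_real_derivative g m x) (at x)"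
      by (rule continuous_antiderivative[OF cont]) blast
    \<comment> \<open>Normalising the primitive at 0 bounds \<open>\<bar>x * f x\<bar>\<close> by
      \<open>(1 + \<bar>x\<bar>) powr r\<close>, uniformly in the truncation level
      \<open>m\<close>.\<close>
    define f where "f x = G x - G 0" for x
    have f: "(f has_real_derivative g m x) (at x)" for x
      unfolding f_def by (auto intro!: derivative_eq_intros G)
    have f_m [measurable]: "f \<in> borel_measurable borel"
      using f by (intro borel_measurable_continuous_onI) (meson DERIV_continuous continuous_at_imp_continuous_on)
    have f_bound: "\<bar>x * f x\<bar> \<le> (1 + \<bar>x\<bar>) powr r" for x
    proof -
      have "norm (f x - f 0) \<le> (1 + \<bar>x\<bar>) powr (r - 2) * norm (x - 0)"
      proof (rule field_differentiable_bound[where S="cball 0 \<bar>x\<bar>" and f'="g m"])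
        show "norm (g m z) \<le> (1 + \<bar>x\<bar>) powr (r - 2)" if "z \<in> cball 0 \<bar>x\<bar>" for z
        proof -
          have "(1 + \<bar>z\<bar>) powr (r - 2) \<le> (1 + \<bar>x\<bar>) powr (r - 2)"
            using that r by (intro powr_mono2) auto
          then show ?thesis by (simp add: g_def)
        qed
      qed (auto intro: f has_field_derivative_at_within)
      then have "\<bar>x\<bar> * \<bar>f x\<bar> \<le> \<bar>x\<bar> * ((1 + \<bar>x\<bar>) powr (r - 2) * \<bar>x\<bar>)"
        by (intro mult_left_mono) (auto simp: f_def)
      also have "\<dots> \<le> (1 + \<bar>x\<bar>) * ((1 + \<bar>x\<bar>) powr (r - 2) * (1 + \<bar>x\<bar>))"
        by (intro mult_mono) auto
      also have "\<dots> = (1 + \<bar>x\<bar>) powr r" by (simp add: powr_diff power2_eq_square)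
      finally show ?thesis by (simp add: abs_mult)
    qed
    have Xr: "integrable M (\<lambda>\<omega>. (1 + \<bar>X \<omega>\<bar>) powr r)" using X by (simp add: abs_moment_def)
    have int: "integrable M (\<lambda>\<omega>. X \<omega> * f (X \<omega>))"
      by (rule Bochner_Integration.integrable_bound[OF Xr]) (use f_bound in auto)
    have "Var M X * (\<integral>\<omega>. g m (Xs \<omega>) \<partial>M) = (\<integral>\<omega>. X \<omega> * f (X \<omega>) \<partial>M)"
      using zb f int g_int[of m] unfolding zero_biased_def by metis
    also have "\<dots> \<le> (\<integral>\<omega>. (1 + \<bar>X \<omega>\<bar>) powr r \<partial>M)"
      by (rule integral_mono[OF int Xr]) (use f_bound abs_le_D1 in blast)
    finally show ?thesis using var by (simp add: field_simps)
  qed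
  \<comment> \<open>The integrals increase and are bounded uniformly in \<open>m\<close>, so
    monotone convergence yields integrability of the untruncated power.\<close>
  have "incseq (\<lambda>m. \<integral>\<omega>. g m (Xs \<omega>) \<partial>M)"
    by (intro incseq_SucI integral_mono g_int) (auto simp: g_def)
  then obtain L where L: "(\<lambda>m. \<integral>\<omega>. g m (Xs \<omega>) \<partial>M) \<longlonglongrightarrow> L"
    using incseq_convergent[OF _ ] bnd by metis
  have "integrable M (\<lambda>\<omega>. (1 + \<bar>Xs \<omega>\<bar>) powr (r - 2))"
  proof (rule integrable_monotone_convergence[OF g_int _ _ L])
    show "AE \<omega> in M. mono (\<lambda>m. g m (Xs \<omega>))" by (auto simp: g_def mono_def)
    show "AE \<omega> in M. (\<lambda>m. g m (Xs \<omega>)) \<longlonglongrightarrow> (1 + \<bar>Xs \<omega>\<bar>) powr (r - 2)"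
    proof (rule AE_I2, rule tendsto_eventually)
      fix \<omega>
      show "\<forall>\<^sub>F m in sequentially. g m (Xs \<omega>) = (1 + \<bar>Xs \<omega>\<bar>) powr (r - 2)"
        using eventually_ge_at_top[of "nat \<lceil>(1 + \<bar>Xs \<omega>\<bar>) powr (r - 2)\<rceil>"]
        by eventually_elim (simp add: g_def min_def ceiling_le_iff nat_le_iff)
    qed
    show "(\<lambda>\<omega>. (1 + \<bar>Xs \<omega>\<bar>) powr (r - 2)) \<in> borel_measurable M" by simp
  qed
  then show ?thesis by (simp add: abs_moment_def)
qed

text \<open>Fubini for the joint law, which is a product by independence. It allows \<open>V\<close>
  to be frozen at a value \<open>v\<close>.\<close>

lemma (in prob_space) indep_var_iterated_expectation:
  fixes F :: "real \<times> real \<Rightarrow> real"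
  assumes ind: "indep_var borel V borel Y" and F [measurable]: "F \<in> borel_measurable (borel \<Otimes>\<^sub>M borel)"
    and int: "integrable M (\<lambda>\<omega>. F (V \<omega>, Y \<omega>))"
  shows "(\<integral>\<omega>. F (V \<omega>, Y \<omega>) \<partial>M) = (\<integral>v. (\<integral>\<omega>. F (v, Y \<omega>) \<partial>M) \<partial>distr M borel V)"
proof -
  have [measurable]: "V \<in> borel_measurable M" "Y \<in> borel_measurable M"
    using ind indep_var_rv1 indep_var_rv2 by auto
  have D: "distr M borel V \<Otimes>\<^sub>M distr M borel Y = distr M (borel \<Otimes>\<^sub>M borel) (\<lambda>x. (V x, Y x))"
    using ind by (simp add: indep_var_distribution_eq)
  interpret V: prob_space "distr M borel V" by (rule prob_space_distr) simp
  interpret Y: prob_space "distr M borel Y" by (rule prob_space_distr) simp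
  interpret VY: pair_sigma_finite "distr M borel V" "distr M borel Y" ..
  have i: "integrable (distr M borel V \<Otimes>\<^sub>M distr M borel Y) F"
    unfolding D using int by (simp add: integrable_distr_eq)
  have "(\<integral>\<omega>. F (V \<omega>, Y \<omega>) \<partial>M) = integral\<^sup>L (distr M borel V \<Otimes>\<^sub>M distr M borel Y) F"
    unfolding D by (simp add: integral_distr)
  also have "\<dots> = (\<integral>v. (\<integral>y. F (v, y) \<partial>distr M borel Y) \<partial>distr M borel V)"
    by (rule VY.integral_fst'[OF i, symmetric])
  also have "\<dots> = (\<integral>v. (\<integral>\<omega>. F (v, Y \<omega>) \<partial>M) \<partial>distr M borel V)"
    by (intro Bochner_Integration.integral_cong refl integral_distr) auto
  finally show ?thesis .
qed

text \<open>With \<open>t = 1 + \<bar>V\<bar> + \<bar>X\<bar>\<close>, the first factor is at most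
  \<open>t\<close> and the second at most \<open>C * t powr (r - 1)\<close>, so a moment of order
  \<open>r\<close> suffices.\<close>

lemma (in prob_space) abs_moment_times_integrable:
  assumes V: "abs_moment M r V" and X: "abs_moment M r X" and r: "1 \<le> r"
    and f: "growth (r - 1) f" "f \<in> borel_measurable borel"
  shows "integrable M (\<lambda>\<omega>. X \<omega> * f (V \<omega> + X \<omega>))"
proof -
  have m [measurable]: "V \<in> borel_measurable M" "X \<in> borel_measurable M"
    using V X by (auto simp: abs_moment_def)
  obtain C where C: "0 \<le> C" "\<And>x. \<bar>f x\<bar> \<le> C * (1 + \<bar>x\<bar>) powr (r - 1)"
    by (rule growthE[OF f(1)]) blast
  have aV: "abs_moment M r (\<lambda>\<omega>. \<bar>V \<omega>\<bar>)" and aX: "abs_moment M r (\<lambda>\<omega>. \<bar>X \<omega>\<bar>)"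
    using V X by (auto simp: abs_moment_def)
  have "integrable M (\<lambda>\<omega>. C * (1 + \<bar>\<bar>V \<omega>\<bar> + \<bar>X \<omega>\<bar>\<bar>) powr r)"
    using abs_moment_add[OF aV aX] r by (simp add: abs_moment_def)
  then show ?thesis
  proof (rule Bochner_Integration.integrable_bound)
    show "(\<lambda>\<omega>. X \<omega> * f (V \<omega> + X \<omega>)) \<in> borel_measurable M" using f(2) by measurable
    show "AE \<omega> in M. norm (X \<omega> * f (V \<omega> + X \<omega>)) \<le> norm (C * (1 + \<bar>\<bar>V \<omega>\<bar> + \<bar>X \<omega>\<bar>\<bar>) powr r)"
    proof (rule AE_I2)
      fix \<omega>
      define t where "t = 1 + \<bar>\<bar>V \<omega>\<bar> + \<bar>X \<omega>\<bar>\<bar>"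
      have t: "1 \<le> t" "\<bar>X \<omega>\<bar> \<le> t" by (auto simp: t_def)
      have "\<bar>X \<omega>\<bar> * \<bar>f (V \<omega> + X \<omega>)\<bar> \<le> t * (C * t powr (r - 1))"
      proof (rule mult_mono[OF t(2)])
        have "(1 + \<bar>V \<omega> + X \<omega>\<bar>) powr (r - 1) \<le> t powr (r - 1)"
          using r by (intro powr_mono2) (auto simp: t_def)
        then show "\<bar>f (V \<omega> + X \<omega>)\<bar> \<le> C * t powr (r - 1)"
          using C(2)[of "V \<omega> + X \<omega>"] mult_left_mono[OF _ C(1)] by (meson order_trans)
      qed (use t in auto)
      also have "\<dots> = C * t powr r" using t by (simp add: powr_diff)
      finally show "norm (X \<omega> * f (V \<omega> + X \<omega>)) \<le> norm (C * (1 + \<bar>\<bar>V \<omega>\<bar> + \<bar>X \<omega>\<bar>\<bar>) powr r)"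
        using C by (simp add: t_def abs_mult)
    qed
  qed
qed

lemma (in prob_space) abs_moment_const: "abs_moment M r (\<lambda>_. c)"
  by (simp add: abs_moment_def)

text \<open>For each fixed \<open>v\<close> the zero bias identity is applied to the translate of
  \<open>f\<close> by \<open>v\<close>. Both sides are then averaged over the law of
  \<open>V\<close>, using its independence of \<open>X\<close> and of \<open>Xs\<close>
  respectively.\<close>

lemma (in prob_space) zero_biased_indep:
  assumes V: "abs_moment M r V" and X: "abs_moment M r X" and r: "2 \<le> r"
    and zb: "zero_biased M X Xs" and var: "0 < Var M X"
    and VX: "indep_var borel V borel X" and VXs: "indep_var borel V borel Xs"
    and f: "\<And>x. (f has_real_derivative f' x) (at x)" "growth (r - 1) f"
    and f': "growth (r - 2) f'" "f' \<in> borel_measurable borel"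
  shows "(\<integral>\<omega>. X \<omega> * f (V \<omega> + X \<omega>) \<partial>M) = Var M X * (\<integral>\<omega>. f' (V \<omega> + Xs \<omega>) \<partial>M)"
proof -
  have Xs: "abs_moment M (r - 2) Xs" by (rule zero_biased_abs_moment[OF X r zb var])
  have V': "abs_moment M (r - 2) V" using abs_moment_mono[OF V] by simp
  have [measurable]: "f' \<in> borel_measurable borel" by fact
  have fm [measurable]: "f \<in> borel_measurable borel"
    using f(1) by (intro borel_measurable_continuous_onI) (meson DERIV_continuous continuous_at_imp_continuous_on)
  have i1: "integrable M (\<lambda>\<omega>. f' (U \<omega> + Xs \<omega>))" if "abs_moment M (r - 2) U" for U
    using abs_moment_integrable[OF abs_moment_add[OF that Xs] f' order_refl] r by simp
  have i2: "integrable M (\<lambda>\<omega>. X \<omega> * f (U \<omega> + X \<omega>))" if "abs_moment M r U" for U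
    using abs_moment_times_integrable[OF that X _ f(2) fm] r by simp
  have pt: "(\<integral>\<omega>. X \<omega> * f (v + X \<omega>) \<partial>M) = Var M X * (\<integral>\<omega>. f' (v + Xs \<omega>) \<partial>M)" for v
  proof -
    have "((\<lambda>x. f (v + x)) has_real_derivative f' (v + x)) (at x)" for x
      using f(1)[of "x + v"] unfolding DERIV_shift by (simp add: add.commute)
    then show ?thesis
      using zb i1[OF abs_moment_const[of _ v]] i2[OF abs_moment_const[of _ v]] unfolding zero_biased_def
      by (elim conjE allE[where x="\<lambda>x. f (v + x)"] allE[where x="\<lambda>x. f' (v + x)"]) auto
  qed
  have "(\<integral>\<omega>. X \<omega> * f (V \<omega> + X \<omega>) \<partial>M) =
      (\<integral>v. (\<integral>\<omega>. X \<omega> * f (v + X \<omega>) \<partial>M) \<partial>distr M borel V)"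
    using indep_var_iterated_expectation[OF VX, of "\<lambda>(v, x). x * f (v + x)"] i2[OF V] by simp
  also have "\<dots> = Var M X * (\<integral>v. (\<integral>\<omega>. f' (v + Xs \<omega>) \<partial>M) \<partial>distr M borel V)"
    unfolding pt by simp
  also have "(\<integral>v. (\<integral>\<omega>. f' (v + Xs \<omega>) \<partial>M) \<partial>distr M borel V) = (\<integral>\<omega>. f' (V \<omega> + Xs \<omega>) \<partial>M)"
    using indep_var_iterated_expectation[OF VXs, of "\<lambda>(v, x). f' (v + x)"] i1[OF V'] by simp
  finally show ?thesis .
qed


lemma (in prob_space) indep_set_commute: "indep_set A B \<Longrightarrow> indep_set B A"
  unfolding indep_sets2_eq by (metis Int_commute mult.commute)

lemma (in prob_space) indep_var_commute: "indep_var S X T Y \<Longrightarrow> indep_var T Y S X"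
  unfolding indep_var_eq by (simp add: indep_set_commute)

section \<open>The expansion\<close>

text \<open>The moment order \<open>r\<close> is fixed once, while the recursion lowers
  \<open>N\<close> and keeps \<open>q\<close>; the requirement
  \<open>real N + max q 2 \<le> r\<close> therefore persists.\<close>

locale zero_bias_sum = prob_space M for M :: "'a measure" +
  fixes n :: nat and X Xs :: "nat \<Rightarrow> 'a \<Rightarrow> real" and r :: real
  assumes r: "2 \<le> r" and n: "1 \<le> n"
    and indep: "indep_vars (\<lambda>_. borel) X {1..n}"
    and moment: "\<And>i. i \<in> {1..n} \<Longrightarrow> abs_moment M r (X i)"
    and mean: "\<And>i. i \<in> {1..n} \<Longrightarrow> expectation (X i) = 0"
    and var: "\<And>i. i \<in> {1..n} \<Longrightarrow> 0 < Var M (X i)"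
    and zero_bias: "\<And>i. i \<in> {1..n} \<Longrightarrow> zero_biased M (X i) (Xs i)"
    and indep_Xs: "\<And>i. i \<in> {1..n} \<Longrightarrow> indep_var borel (Wi n X i) borel (Xs i)"
begin

section \<open>Moments, independence and variance of the sum\<close>

lemma Wi_eq_sum: "i \<in> {1..n} \<Longrightarrow> Wi n X i = (\<lambda>\<omega>. \<Sum>j\<in>{1..n} - {i}. X j \<omega>)"
  by (auto simp: Wi_def W_def sum_diff1)

lemma W_eq: "W n X \<omega> = Wi n X i \<omega> + X i \<omega>"
  by (simp add: Wi_def)

lemma moment_W: "abs_moment M r (W n X)"
  unfolding W_def[abs_def] using moment r by (intro abs_moment_sum) auto

lemma moment_Wi: "i \<in> {1..n} \<Longrightarrow> abs_moment M r (Wi n X i)"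
  unfolding Wi_eq_sum using moment r by (intro abs_moment_sum) auto

lemma moment_Xs: "i \<in> {1..n} \<Longrightarrow> abs_moment M (r - 2) (Xs i)"
  by (rule zero_biased_abs_moment[OF moment r zero_bias var])

lemma indep_Wi:
  assumes "i \<in> {1..n}"
  shows "indep_var borel (Wi n X i) borel (X i)"
proof -
  have "indep_var borel (X i) borel (\<lambda>\<omega>. \<Sum>j\<in>{1..n} - {i}. X j \<omega>)"
    using assms indep by (intro indep_vars_sum) (auto simp: insert_absorb)
  then show ?thesis
    unfolding Wi_eq_sum[OF assms] by (rule indep_var_commute)
qed

lemma integrable_X: "i \<in> {1..n} \<Longrightarrow> integrable M (X i)"
  using abs_moment_mom_wd[OF moment, of i 1] r by (simp add: mom_wd_def)

lemma integrable_X_times_W: "i \<in> {1..n} \<Longrightarrow> integrable M (\<lambda>\<omega>. X i \<omega> * W n X \<omega>)"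
proof -
  assume i: "i \<in> {1..n}"
  have "growth 1 (\<lambda>x. x)" by (rule growthI[where C=1]) simp
  then have "growth (r - 1) (\<lambda>x. x)" by (rule growth_mono) (use r in simp)
  then show ?thesis
    unfolding W_eq[of _ i] using r by (intro abs_moment_times_integrable[OF moment_Wi[OF i] moment[OF i]]) auto
qed

text \<open>The cross term with \<open>Wi\<close> vanishes by independence and zero mean, leaving
  the second moment of \<open>X i\<close>.\<close>

lemma expectation_X_times_W:
  assumes i: "i \<in> {1..n}"
  shows "expectation (\<lambda>\<omega>. X i \<omega> * W n X \<omega>) = Var M (X i)"
proof -
  have Wi: "integrable M (Wi n X i)"
    using abs_moment_mom_wd[OF moment_Wi[OF i], of 1] r by (simp add: mom_wd_def)
  have sq: "integrable M (\<lambda>\<omega>. (X i \<omega>)\<^sup>2)"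
    using abs_moment_mom_wd[OF moment[OF i], of 2] r by (simp add: mom_wd_def)
  have iv: "integrable M (\<lambda>\<omega>. Wi n X i \<omega> * X i \<omega>)"
    by (rule indep_var_integrable[OF indep_Wi[OF i] Wi integrable_X[OF i]])
  have "expectation (\<lambda>\<omega>. Wi n X i \<omega> * X i \<omega>) = 0"
    using indep_var_lebesgue_integral[OF indep_Wi[OF i] Wi integrable_X[OF i]] mean[OF i] by simp
  moreover have "(\<lambda>\<omega>. X i \<omega> * W n X \<omega>) = (\<lambda>\<omega>. Wi n X i \<omega> * X i \<omega> + (X i \<omega>)\<^sup>2)"
    by (simp add: W_eq[of _ i] algebra_simps power2_eq_square)
  ultimately show ?thesis
    using iv sq mean[OF i] by (simp add: Var_def)
qed

lemma Var_W: "Var M (W n X) = (\<Sum>i=1..n. Var M (X i))"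
proof -
  have "expectation (W n X) = 0"
    unfolding W_def[abs_def] using integrable_X mean by (subst Bochner_Integration.integral_sum) auto
  then have "Var M (W n X) = expectation (\<lambda>\<omega>. (W n X \<omega>)\<^sup>2)"
    by (simp add: Var_def)
  also have "(\<lambda>\<omega>. (W n X \<omega>)\<^sup>2) = (\<lambda>\<omega>. \<Sum>i=1..n. X i \<omega> * W n X \<omega>)"
    by (simp only: power2_eq_square sum_distrib_right[symmetric] W_def[symmetric])
  also have "expectation \<dots> = (\<Sum>i=1..n. Var M (X i))"
    using integrable_X_times_W expectation_X_times_W by (subst Bochner_Integration.integral_sum) auto
  finally show ?thesis .
qed

lemma Var_W_pos: "0 < Var M (W n X)"
  unfolding Var_W using var n by (intro sum_pos) auto

lemma sigmaW_pos: "0 < sigmaW M n X"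
  using Var_W_pos by (simp add: sigmaW_def)

lemma sigmaW_sq: "(sigmaW M n X)\<^sup>2 = (\<Sum>i=1..n. Var M (X i))"
  using Var_W_pos Var_W by (simp add: sigmaW_def)

lemma mom_wd_X: "i \<in> {1..n} \<Longrightarrow> real k \<le> r \<Longrightarrow> mom_wd M (X i) k"
  by (rule abs_moment_mom_wd[OF moment])

lemma mom_wd_Xs: "i \<in> {1..n} \<Longrightarrow> real k \<le> r - 2 \<Longrightarrow> mom_wd M (Xs i) k"
  by (rule abs_moment_mom_wd[OF moment_Xs])

text \<open>The list \<open>K\<close> covers both uses, \<open>J\<close> itself and
  \<open>butlast J\<close>. Entries are bounded by the total of \<open>J\<close>, hence by
  \<open>N\<close>.\<close>

lemma momJ_wd_mindex:
  assumes "i \<in> {1..n}" "real N \<le> r" "J \<in> mindex d N" "set K \<subseteq> set J"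
  shows "momJ_wd M (X i) K"
  unfolding momJ_wd_def
proof
  fix j assume "j \<in> set K"
  then have "j \<le> N" using assms(3,4) member_le_sum_list[of j J] by (auto simp: mindex_def)
  then show "mom_wd M (X i) j" using assms(1,2) by (intro mom_wd_X) auto
qed

section \<open>One step of the recursion\<close>

context
  fixes N :: nat and q :: real and h f :: jet and S :: real
  assumes N: "1 \<le> N" and q: "0 \<le> q" and Nq: "real N + max q 2 \<le> r" and h: "jet_class N q h"
  defines "S \<equiv> sigmaW M n X"
  defines "f \<equiv> stein S h"
begin

lemma S_pos: "0 < S" by (simp add: S_def sigmaW_pos)

lemmas stein_facts = stein_growth_le[OF N q S_pos h, folded f_def]
  stein_measurable[OF N q S_pos h, folded f_def]

lemma integrable_stein_W:
  assumes "k \<le> Suc N" "abs_moment M r Y"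
  shows "integrable M (\<lambda>\<omega>. f k (Y \<omega>))"
  using Nq by (intro abs_moment_integrable[OF assms(2) stein_facts] assms(1)) auto

text \<open>The exponent \<open>N + q - 2\<close> is at most \<open>r - 2\<close>, the order of the
  moments that \<open>Xs i\<close> has.\<close>

lemma f1_growth: "growth (r - 2) (f 1)"
  using stein_growth_all[OF N q S_pos h, of 1] N Nq unfolding f_def by (auto elim!: growth_mono)

lemma f0_growth: "growth (r - 1) (f 0)"
  using stein_growth_all[OF N q S_pos h, of 0] N Nq unfolding f_def by (auto elim!: growth_mono)

lemma f_measurable: "f 0 \<in> borel_measurable borel" "f 1 \<in> borel_measurable borel"
  using stein_facts(2) N by auto

lemma f_deriv: "(f 0 has_real_derivative f 1 x) (at x)"
  unfolding f_def by (rule stein_0_deriv[OF N q S_pos h])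

lemma zero_bias_f:
  assumes "i \<in> {1..n}"
  shows "expectation (\<lambda>\<omega>. X i \<omega> * f 0 (W n X \<omega>)) = Var M (X i) * expectation (\<lambda>\<omega>. f 1 (Wi n X i \<omega> + Xs i \<omega>))"
  unfolding W_eq[of _ i]
  by (rule zero_biased_indep[OF moment_Wi moment r zero_bias var indep_Wi indep_Xs f_deriv f0_growth f1_growth f_measurable(2)]) (rule assms)+

text \<open>Stein's equation is evaluated at \<open>W\<close>. The term with \<open>W\<close> as a
  factor splits into the \<open>X i\<close>, to which zero bias applies, and
  \<open>S\<^sup>2\<close> splits into the variances. In the second expectation \<open>W\<close> is
  written as \<open>Wi + X i\<close>, to match \<open>zero_bias_expansion\<close>.\<close>

lemma expectation_h_W:
  "expectation (\<lambda>\<omega>. h 0 (W n X \<omega>)) = Phi S (h 0) + (\<Sum>i=1..n. Var M (X i) *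
     (expectation (\<lambda>\<omega>. f 1 (Wi n X i \<omega> + Xs i \<omega>)) - expectation (\<lambda>\<omega>. f 1 (Wi n X i \<omega> + X i \<omega>))))"
proof -
  define c where "c = Phi S (h 0)"
  have hW: "h 0 w = c + (w * f 0 w - S\<^sup>2 * f 1 w)" for w
    using S_pos by (simp add: c_def f_def stein.simps(2))
  have i1: "integrable M (\<lambda>\<omega>. f 1 (W n X \<omega>))"
    using N by (intro integrable_stein_W moment_W) auto
  have i0: "integrable M (\<lambda>\<omega>. X i \<omega> * f 0 (W n X \<omega>))" if "i \<in> {1..n}" for i
    unfolding W_eq[of _ i] using r
    by (intro abs_moment_times_integrable[OF moment_Wi[OF that] moment[OF that] _ f0_growth f_measurable(1)]) simp
  have Wf: "(\<lambda>\<omega>. W n X \<omega> * f 0 (W n X \<omega>)) = (\<lambda>\<omega>. \<Sum>i=1..n. X i \<omega> * f 0 (W n X \<omega>))"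
    by (simp only: sum_distrib_right[symmetric] W_def[symmetric])
  have iW: "integrable M (\<lambda>\<omega>. W n X \<omega> * f 0 (W n X \<omega>))"
    unfolding Wf using i0 by (intro Bochner_Integration.integrable_sum) auto
  have "expectation (\<lambda>\<omega>. h 0 (W n X \<omega>)) = c +
      (expectation (\<lambda>\<omega>. W n X \<omega> * f 0 (W n X \<omega>)) - S\<^sup>2 * expectation (\<lambda>\<omega>. f 1 (W n X \<omega>)))"
    unfolding hW using i1 iW by (simp add: prob_space)
  also have "expectation (\<lambda>\<omega>. W n X \<omega> * f 0 (W n X \<omega>)) =
      (\<Sum>i=1..n. Var M (X i) * expectation (\<lambda>\<omega>. f 1 (Wi n X i \<omega> + Xs i \<omega>)))"
    unfolding Wf using i0 by (subst Bochner_Integration.integral_sum) (auto simp: zero_bias_f)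
  also have "S\<^sup>2 * expectation (\<lambda>\<omega>. f 1 (W n X \<omega>)) =
      (\<Sum>i=1..n. Var M (X i) * expectation (\<lambda>\<omega>. f 1 (Wi n X i \<omega> + X i \<omega>)))"
    unfolding S_def sigmaW_sq sum_distrib_right by (simp add: W_eq[symmetric])
  finally show ?thesis by (simp add: c_def right_diff_distrib sum_subtractf)
qed

text \<open>No derivative of order above \<open>Suc N\<close> occurs, so the growth is at most
  \<open>N + q \<le> r\<close>, and both \<open>W\<close> and \<open>Wi\<close> have moments of
  order \<open>r\<close>.\<close>

lemma eps_well_defined:
  assumes i: "i \<in> {1..n}" and k: "k \<le> N"
  shows "eps_wd M (N - k) (jet_deriv (k + 1) f) (Wi n X i) (X i)"
  unfolding eps_wd_def delta_wd_def jet_deriv_def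
proof (intro allI ballI conjI impI)
  fix d J assume J: "J \<in> mindex d (N - k)"
  have le: "sum_list J \<le> N - k" by (rule mindex_sum_le[OF J])
  have Nr: "real N \<le> r" using Nq by simp
  then show "momJ_wd M (X i) J"
    using momJ_wd_mindex[OF i, of "N - k"] J k by auto
  show "integrable M (\<lambda>\<omega>. f (0 + sum_list J + (k + 1)) (Wi n X i \<omega> + X i \<omega>))"
    unfolding W_eq[symmetric] using le k by (intro integrable_stein_W moment_W) auto
  fix l assume l: "l \<le> N - k - sum_list J"
  then show "mom_wd M (X i) l" using Nr by (intro mom_wd_X i) auto
  show "integrable M (\<lambda>\<omega>. f (l + sum_list J + (k + 1)) (Wi n X i \<omega>))"
    using l le k by (intro integrable_stein_W moment_Wi i) auto
qed

text \<open>Only the leading term evaluates a derivative at a sum containing \<open>Xs i\<close>,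
  and there \<open>f1_growth\<close> fits moments of order \<open>r - 2\<close>. The moments of
  \<open>Xs i\<close> up to order \<open>N\<close> exist because
  \<open>max q 2 \<ge> 2\<close>.\<close>

lemma delta_well_defined:
  assumes i: "i \<in> {1..n}"
  shows "delta_wd M N (jet_deriv 1 f) (Wi n X i) (Xs i)"
  unfolding delta_wd_def jet_deriv_def
proof (intro conjI allI impI)
  have Wi: "abs_moment M (r - 2) (Wi n X i)"
    using abs_moment_mono[OF moment_Wi[OF i]] by simp
  show "integrable M (\<lambda>\<omega>. f (0 + 1) (Wi n X i \<omega> + Xs i \<omega>))"
    using abs_moment_integrable[OF abs_moment_add[OF Wi moment_Xs[OF i]] f1_growth f_measurable(2)] r by simp
  fix k assume k: "k \<le> N"
  then show "mom_wd M (Xs i) k" using Nq by (intro mom_wd_Xs i) auto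
  show "integrable M (\<lambda>\<omega>. f (k + 1) (Wi n X i \<omega>))"
    using k by (intro integrable_stein_W moment_Wi i) auto
qed

lemma moments_well_defined:
  assumes i: "i \<in> {1..n}" and d: "d \<in> {1..N}" and J: "J \<in> mindex d N"
  shows "momJ_wd M (X i) (butlast J)" "mom_wd M (Xs i) (last J)" "mom_wd M (X i) (last J)"
proof -
  have Nr: "real N \<le> r" "real N \<le> r - 2" using Nq by auto
  show "momJ_wd M (X i) (butlast J)"
    by (rule momJ_wd_mindex[OF i Nr(1) J]) (auto dest: in_set_butlastD)
  have "J \<noteq> []" using d J by (auto simp: mindex_def)
  then have "last J \<le> N"
    using J member_le_sum_list[of "last J" J] by (auto simp: mindex_def)
  then show "mom_wd M (Xs i) (last J)" "mom_wd M (X i) (last J)"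
    using Nr by (auto intro!: mom_wd_Xs mom_wd_X i)
qed

text \<open>The hypothesis splits each remaining expectation at \<open>W\<close> into a
  \<open>C_exp\<close> and an \<open>e_exp\<close> part, which distributes the main sum over the two
  formulas. The terms with \<open>eps\<close> and \<open>delta\<close> all go to
  \<open>e_exp\<close>.\<close>

lemma expansion_step:
  assumes IH: "\<And>d J. d \<in> {1..N} \<Longrightarrow> J \<in> mindex d N \<Longrightarrow>
      C_wd M n X Xs (N - sum_list J) (jet_deriv (sum_list J + 1) f) \<and>
      e_wd M n X Xs (N - sum_list J) (jet_deriv (sum_list J + 1) f) \<and>
      expectation (\<lambda>\<omega>. f (sum_list J + 1) (W n X \<omega>)) =
        C_exp M n X Xs (N - sum_list J) (jet_deriv (sum_list J + 1) f) +
        e_exp M n X Xs (N - sum_list J) (jet_deriv (sum_list J + 1) f)"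
  shows "C_wd M n X Xs N h \<and> e_wd M n X Xs N h \<and>
    expectation (\<lambda>\<omega>. h 0 (W n X \<omega>)) = C_exp M n X Xs N h + e_exp M n X Xs N h"
proof (intro conjI)
  have swd: "stein_wd (Suc N) S h" by (rule stein_well_defined[OF N q S_pos h])
  then show "C_wd M n X Xs N h"
    unfolding C_wd.simps[of M n X Xs N h] S_def[symmetric] f_def[symmetric]
    using IH moments_well_defined by (auto simp: stein_wd_def)
  show "e_wd M n X Xs N h"
    unfolding e_wd.simps[of M n X Xs N h] S_def[symmetric] f_def[symmetric]
    using N IH moments_well_defined eps_well_defined delta_well_defined swd
      mom_wd_Xs Nq by auto
  define c where "c i J = momJ M (X i) (butlast J) * (mom M (Xs i) (last J) - mom M (X i) (last J))" for i J
  define rest where "rest i = (\<Sum>k=0..N. eps M (N - k) (jet_deriv (k + 1) f) (Wi n X i) (X i) * mom M (Xs i) k)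
      + delta M N (jet_deriv 1 f) (Wi n X i) (Xs i)" for i
  define C where "C J = C_exp M n X Xs (N - sum_list J) (jet_deriv (sum_list J + 1) f)" for J
  define E where "E J = e_exp M n X Xs (N - sum_list J) (jet_deriv (sum_list J + 1) f)" for J
  have "expectation (\<lambda>\<omega>. f 1 (Wi n X i \<omega> + Xs i \<omega>)) - expectation (\<lambda>\<omega>. f 1 (Wi n X i \<omega> + X i \<omega>)) =
      (\<Sum>d=1..N. (-1) ^ (d - 1) * (\<Sum>J\<in>mindex d N. c i J * C J)) +
      ((\<Sum>d=1..N. (-1) ^ (d - 1) * (\<Sum>J\<in>mindex d N. c i J * E J)) + rest i)" for i
  proof -
    have "expectation (\<lambda>\<omega>. f 1 (Wi n X i \<omega> + Xs i \<omega>)) - expectation (\<lambda>\<omega>. f 1 (Wi n X i \<omega> + X i \<omega>)) =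
      (\<Sum>d=1..N. (-1) ^ (d - 1) * (\<Sum>J\<in>mindex d N. c i J * expectation (\<lambda>\<omega>. f (sum_list J + 1) (W n X \<omega>)))) + rest i"
      using zero_bias_expansion[where f="jet_deriv 1 f" and X="Wi n X i" and Z="Xs i" and Y="X i" and N=N]
      by (simp add: jet_deriv_def c_def rest_def W_eq[of _ i])
    also have "(\<Sum>d=1..N. (-1) ^ (d - 1) * (\<Sum>J\<in>mindex d N. c i J * expectation (\<lambda>\<omega>. f (sum_list J + 1) (W n X \<omega>)))) =
      (\<Sum>d=1..N. (-1) ^ (d - 1) * (\<Sum>J\<in>mindex d N. c i J * (C J + E J)))"
      unfolding C_def E_def
      by (intro sum.cong refl arg_cong2[where f="(*)"]) (use IH in blast)
    finally show ?thesis by (simp add: distrib_left sum.distrib)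
  qed
  then show "expectation (\<lambda>\<omega>. h 0 (W n X \<omega>)) = C_exp M n X Xs N h + e_exp M n X Xs N h"
    unfolding expectation_h_W C_exp.simps[of M n X Xs N h] e_exp.simps[of M n X Xs N h]
      S_def[symmetric] f_def[symmetric]
    using N by (simp add: c_def rest_def C_def E_def distrib_left sum.distrib add.assoc)
qed

end

text \<open>Strong induction on \<open>N\<close> for arbitrary jets, with \<open>q\<close> and
  \<open>r\<close> fixed: a nonempty multi-index has positive total, so the order drops. For
  \<open>N = 0\<close> the identity is the definition of the error term.\<close>

lemma expansion:
  assumes "jet_class N q h" "0 \<le> q" "real N + max q 2 \<le> r"
  shows "integrable M (\<lambda>\<omega>. h 0 (W n X \<omega>)) \<and> C_wd M n X Xs N h \<and> e_wd M n X Xs N h \<and>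
    expectation (\<lambda>\<omega>. h 0 (W n X \<omega>)) = C_exp M n X Xs N h + e_exp M n X Xs N h"
  using assms
proof (induction N arbitrary: h rule: less_induct)
  case (less N)
  have g: "growth (real N + q) (h 0)" and m: "h 0 \<in> borel_measurable borel"
    using jet_class_growth[OF less.prems(1,2), of 0] jet_class_measurable[OF less.prems(1), of 0] by auto
  have int: "integrable M (\<lambda>\<omega>. h 0 (W n X \<omega>))"
    using less.prems(3) by (intro abs_moment_integrable[OF moment_W g m]) simp
  have Phi: "Phi_wd (sigmaW M n X) (h 0)"
    by (rule Phi_wd_growth[OF g m sigmaW_pos])
  show ?case
  proof (cases "N = 0")
    case True
    then show ?thesis
      using int Phi
      by (simp add: C_wd.simps[of M n X Xs 0 h] e_wd.simps[of M n X Xs 0 h] C_exp.simps[of M n X Xs 0 h] e_exp.simps[of M n X Xs 0 h])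
  next
    case False
    then have N: "1 \<le> N" by simp
    have "C_wd M n X Xs N h \<and> e_wd M n X Xs N h \<and>
      expectation (\<lambda>\<omega>. h 0 (W n X \<omega>)) = C_exp M n X Xs N h + e_exp M n X Xs N h"
    proof (rule expansion_step[OF N less.prems(2,3,1)])
      fix d J assume d: "d \<in> {1..N}" and J: "J \<in> mindex d N"
      let ?j = "sum_list J" and ?f = "stein (sigmaW M n X) h"
      have j: "1 \<le> ?j" "?j \<le> N"
        using d J mindex_length_le_sum[of J] by (auto simp: mindex_def)
      have "jet_class (N - ?j) q (jet_deriv (?j + 1) ?f)"
        by (rule jet_class_stein[OF N less.prems(2) sigmaW_pos less.prems(1) j])
      from less.IH[OF _ this less.prems(2)] j less.prems(3)
      show "C_wd M n X Xs (N - ?j) (jet_deriv (?j + 1) ?f) \<and>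
        e_wd M n X Xs (N - ?j) (jet_deriv (?j + 1) ?f) \<and>
        expectation (\<lambda>\<omega>. ?f (?j + 1) (W n X \<omega>)) =
          C_exp M n X Xs (N - ?j) (jet_deriv (?j + 1) ?f) + e_exp M n X Xs (N - ?j) (jet_deriv (?j + 1) ?f)"
        by (simp add: jet_deriv_def)
    qed
    with int show ?thesis by blast
  qed
qed

end

theorem theorem1p2:
  fixes P :: "'a measure"
    and n N :: nat
    and X Xs :: "nat \<Rightarrow> 'a \<Rightarrow> real"
    and \<alpha> p :: real
    and h :: jet
  assumes "0 < \<alpha>" "\<alpha> \<le> 1" "0 \<le> p"
    and "h \<in> HN N \<alpha> p"
    and "prob_space P"
    and "1 \<le> n"
    and "prob_space.indep_vars P (\<lambda>_. borel) X {1..n}"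
    and "\<And>i. i \<in> {1..n} \<Longrightarrow>
           integrable P (\<lambda>\<omega>. \<bar>X i \<omega>\<bar> powr (real N + max (\<alpha> + p) 2))"
    and "\<And>i. i \<in> {1..n} \<Longrightarrow> (\<integral>\<omega>. X i \<omega> \<partial>P) = 0"
    and "\<And>i. i \<in> {1..n} \<Longrightarrow> 0 < Var P (X i)"
    and "\<And>i. i \<in> {1..n} \<Longrightarrow> zero_biased P (X i) (Xs i)"
    and "\<And>i. i \<in> {1..n} \<Longrightarrow> prob_space.indep_var P borel (Wi n X i) borel (Xs i)"
  shows "integrable P (\<lambda>\<omega>. h 0 (W n X \<omega>)) \<and>
         C_wd P n X Xs N h \<and> e_wd P n X Xs N h \<and>
         (\<integral>\<omega>. h 0 (W n X \<omega>) \<partial>P) = C_exp P n X Xs N h + e_exp P n X Xs N h"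
proof -
  \<comment> \<open>This is \<open>N + max q 2\<close> for the growth exponent
    \<open>q = \<alpha> + p\<close> supplied by \<open>HN_jet_class\<close>.\<close>
  let ?r = "real N + max (\<alpha> + p) 2"
  interpret prob_space P by fact
  have "X i \<in> borel_measurable P" if "i \<in> {1..n}" for i
    using \<open>indep_vars (\<lambda>_. borel) X {1..n}\<close> that by (auto simp: indep_vars_def)
  then have moment: "abs_moment P ?r (X i)" if "i \<in> {1..n}" for i
    using assms(8)[OF that] that by (intro abs_moment_of_powr) (auto simp: finite_measure_axioms)
  interpret zero_bias_sum P n X Xs ?r
    by unfold_locales (use assms moment in auto)
  show ?thesis
    by (rule expansion[OF HN_jet_class[OF assms(4,1,3)]]) (use assms in auto)
qed

end
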